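(* Let $c>0$, let $\{\tilde c_n\}_{n=1}^\infty$ be a real sequence with $\tilde c_n\ge c$ for all $n\ge1$, let $c_n=(-1)^n\tilde c_n$ for $n\ge 1$, and let $\{d_n\}_{n=1}^{\infty}$ be a positive chain sequence. Let $\mu$ be the probability measure on the unit circle associated with the pair of sequences $\{\{c_n\}_{n=1}^{\infty},\{d_n\}_{n=1}^{\infty}\}$. Then the support of $\mu$ lies within $\mathcal{C}_1\cup\mathcal{C}_2$, where $$\mathcal{C}_1=\{z\in\mathbb{T}: 0\le \arg(z)\le \theta_c\},\qquad \mathcal{C}_2=\{z\in\mathbb{T}: 2\pi-\theta_c\le \arg(z)\le 2\pi\},\qquad \theta_c=\arccos\left(\frac{c^2-1}{c^2+1}\right)\in[0,\pi].$$
   Context: $\mathbb{T}=\{z\in\mathbb{C}:|z|=1\}$, and the argument of a point of $\mathbb{T}$ is taken in $[0,2\pi]$ (with $z=1$ having arguments $0$ and $2\pi$). A real sequence $\{d_n\}_{n=1}^\infty$ is a positive chain sequence if there is a sequence $\{g_n\}_{n=0}^\infty$ (a parameter sequence) with $0\le g_0<1$, $0<g_n<1$ for $n\ge1$, and $d_n=(1-g_{n-1})g_n$ for $n\ge1$. The minimal parameter sequence $\{m_n\}_{n=0}^\infty$ is the one with $m_0=0$. For a nontrivial probability measure $\mu$ on $\mathbb{T}$ (infinite support) with monic orthogonal polynomials $\phi_n$, the Verblunsky coefficients are $\alpha_{n-1}=-\overline{\phi_n(0)}$, $n\ge1$; every sequence $\{\alpha_n\}_{n\ge0}$ with $|\alpha_n|<1$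 is the Verblunsky sequence of exactly one nontrivial probability measure on $\mathbb{T}$. The measure associated with a pair $\{\{c_n\}_{n=1}^\infty,\{d_n\}_{n=1}^\infty\}$, where $\{c_n\}$ is real and $\{d_n\}$ is a positive chain sequence with minimal parameter sequence $\{m_n\}$, is the unique nontrivial probability measure on $\mathbb{T}$ with Verblunsky coefficients $$\alpha_{n-1}=\overline{\tau}_{n-1}\,\frac{1-2m_n-ic_n}{1-ic_n},\quad n\ge1,\qquad \tau_0=1,\quad \tau_n=\prod_{k=1}^n\frac{1-ic_k}{1+ic_k}.$$ *)

theory Defs
  imports "HOL-Analysis.Analysis" "HOL-Computational_Algebra.Polynomial"
    "HOL-Probability.Probability"
begin

text \<open>Sequences indexed by \<open>n \<ge> 1\<close> are functions on \<^typ>\<open>nat\<close> whose value at \<open>0\<close> is never used.\<close>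

definition parameter_sequence :: "(nat \<Rightarrow> real) \<Rightarrow> (nat \<Rightarrow> real) \<Rightarrow> bool" where
  "parameter_sequence d g \<longleftrightarrow>
     0 \<le> g 0 \<and> g 0 < 1 \<and> (\<forall>n\<ge>1. 0 < g n \<and> g n < 1) \<and>
     (\<forall>n\<ge>1. d n = (1 - g (n - 1)) * g n)"

definition positive_chain_sequence :: "(nat \<Rightarrow> real) \<Rightarrow> bool" where
  "positive_chain_sequence d \<longleftrightarrow> (\<exists>g. parameter_sequence d g)"

definition minimal_parameter_sequence :: "(nat \<Rightarrow> real) \<Rightarrow> nat \<Rightarrow> real" where
  "minimal_parameter_sequence d = (THE m. parameter_sequence d m \<and> m 0 = 0)"

lemma ex1_minimal_parameter_sequence:
  assumes "positive_chain_sequence d"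
  shows "\<exists>!m. parameter_sequence d m \<and> m 0 = 0"
proof -
  obtain g where g: "parameter_sequence d g"
    using assms by (auto simp: positive_chain_sequence_def)
  have g_lt: "g n < 1" for n
    using g by (cases n) (auto simp: parameter_sequence_def)
  have g_pos: "0 < g (Suc n)" and d_g: "d (Suc n) = (1 - g n) * g (Suc n)" for n
    using g by (auto simp: parameter_sequence_def)
  define m where "m = rec_nat 0 (\<lambda>n x. d (Suc n) / (1 - x))"
  have m_0: "m 0 = 0" and m_Suc: "m (Suc n) = d (Suc n) / (1 - m n)" for n
    by (simp_all add: m_def)
  have m_le: "m n \<le> g n" for n
  proof (induction n)
    case 0
    then show ?case using g by (simp add: m_0 parameter_sequence_def)
  next
    case (Suc n)
    have "(1 - g n) * g (Suc n) \<le> (1 - m n) * g (Suc n)"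
      using Suc g_pos[of n] by (intro mult_right_mono) auto
    moreover have "0 < 1 - m n"
      using Suc g_lt[of n] by simp
    ultimately show ?case
      by (simp add: m_Suc d_g divide_le_eq mult.commute)
  qed
  have m_lt: "m n < 1" for n
    using m_le[of n] g_lt[of n] by simp
  have d_m: "d (Suc n) = (1 - m n) * m (Suc n)" for n
    using m_lt[of n] by (simp add: m_Suc)
  have m_pos: "0 < m (Suc n)" for n
    using m_lt[of n] g_lt[of n] g_pos[of n] by (simp add: m_Suc d_g)
  have "parameter_sequence d m"
    unfolding parameter_sequence_def
  proof (intro conjI allI impI)
    fix n :: nat assume "n \<ge> 1"
    then obtain k where n: "n = Suc k" by (cases n) auto
    show "0 < m n" "m n < 1" "d n = (1 - m (n - 1)) * m n"
      using m_pos[of k] m_lt[of n] d_m[of k] by (simp_all add: n)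
  qed (use m_0 in auto)
  moreover have "m' = m" if m': "parameter_sequence d m'" "m' 0 = 0" for m'
  proof
    fix n show "m' n = m n"
    proof (induction n)
      case (Suc n)
      have "d (Suc n) = (1 - m' n) * m' (Suc n)"
        using m' by (auto simp: parameter_sequence_def)
      then show ?case using Suc m_lt[of n] by (simp add: m_Suc)
    qed (simp add: m_0 m')
  qed
  ultimately show ?thesis using m_0 by blast
qed

definition measure_support :: "'a::topological_space measure \<Rightarrow> 'a set" where
  "measure_support M =
     {x \<in> space M. \<forall>U. open U \<and> x \<in> U \<longrightarrow> emeasure M (U \<inter> space M) > 0}"

definition nontrivial_circle_prob_measure :: "complex measure \<Rightarrow> bool" where
  "nontrivial_circle_prob_measure M \<longleftrightarrow>
     prob_space M \<and> sets M = sets (restrict_space borel (sphere 0 1)) \<and>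
     infinite (measure_support M)"

definition monic_orthogonal_poly :: "complex measure \<Rightarrow> nat \<Rightarrow> complex poly" where
  "monic_orthogonal_poly M n =
     (THE p. degree p = n \<and> lead_coeff p = 1 \<and>
        (\<forall>k<n. (\<integral>z. poly p z * cnj (z ^ k) \<partial>M) = 0))"

definition verblunsky :: "complex measure \<Rightarrow> nat \<Rightarrow> complex" where
  "verblunsky M n = - cnj (poly (monic_orthogonal_poly M (Suc n)) 0)"

definition tau :: "(nat \<Rightarrow> real) \<Rightarrow> nat \<Rightarrow> complex" where
  "tau c n = (\<Prod>k=1..n. (1 - \<i> * c k) / (1 + \<i> * c k))"

text \<open>
  Stated as a relation: by Verblunsky's theorem exactly one measure \<open>M\<close> satisfies it
  for any real sequence \<open>c\<close> and positive chain sequence \<open>d\<close>.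
\<close>

definition associated_measure ::
    "(nat \<Rightarrow> real) \<Rightarrow> (nat \<Rightarrow> real) \<Rightarrow> complex measure \<Rightarrow> bool" where
  "associated_measure c d M \<longleftrightarrow>
     nontrivial_circle_prob_measure M \<and>
     (\<forall>n\<ge>1. verblunsky M (n - 1) =
        cnj (tau c (n - 1)) *
        (1 - 2 * minimal_parameter_sequence d n - \<i> * c n) / (1 - \<i> * c n))"

text \<open>
  Arguments are taken in \<open>[0, 2\<pi>]\<close>, so \<open>z = 1\<close> has the two arguments \<open>0\<close> and \<open>2\<pi>\<close>
  (the library's \<^const>\<open>Arg\<close> and \<^const>\<open>Arg2pi\<close> choose one).
\<close>

definition circle_arc :: "real \<Rightarrow> real \<Rightarrow> complex set" where
  "circle_arc a b =
     {z \<in> sphere 0 1. \<exists>t. 0 \<le> t \<and> t \<le> 2 * pi \<and> z = cis t \<and> a \<le> t \<and> t \<le> b}"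

definition theta :: "real \<Rightarrow> real" where
  "theta c = arccos ((c\<^sup>2 - 1) / (c\<^sup>2 + 1))"

end

theory Submission
  imports Defs
begin

text \<open>
  Put \<open>x = (c\<^sup>2 - 1) / (c\<^sup>2 + 1) = cos \<theta>\<^sub>c\<close>. The union of the two arcs is the part \<open>Re z \<ge> x\<close> of the
  circle, so the claim is that multiplication by \<open>z\<close> on \<open>L\<^sup>2(\<mu>)\<close> has its spectrum there. The proof
  bounds its numerical range: \<open>Re \<langle>z f, f\<rangle> \<ge> x \<langle>f, f\<rangle>\<close> for all Laurent polynomials \<open>f\<close>
  (\<open>numerical_range_laurent\<close>).

  The bound comes from the CMV factorisation of multiplication by \<open>z\<close> into two unitary operators,
  each a direct sum of blocks of size at most two. Let \<open>x\<^sub>k\<close> be the CMV basis obtained by orthogonalising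
  \<open>1, z\<^sup>-\<^sup>1, z, z\<^sup>-\<^sup>2, z\<^sup>2, \<dots>\<close>; the complex conjugates of the \<open>x\<^sub>k\<close> are again an orthogonal basis. For
  \<open>f = \<Sum> b\<^sub>k x\<^sub>k\<close> put \<open>g = \<Sum> b\<^sub>k p\<^sub>k cnj x\<^sub>k\<close> with unimodular \<open>p\<^sub>k\<close>. Then both \<open>\<langle>g, f\<rangle>\<close> and \<open>\<langle>z f, g\<rangle>\<close>
  are block-diagonal quadratic forms in \<open>b\<close>, with blocks on the index pairs \<open>(2i + 1, 2i + 2)\<close> and
  \<open>(2i, 2i + 1)\<close> respectively. If \<open>p\<^sub>k\<close> is \<open>\<tau>\<^sub>k\<close> for even \<open>k\<close> and its conjugate for odd \<open>k\<close>, then the block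
  of the pair \<open>(n - 1, n)\<close> is \<open>I - 2 / (1 + i c\<^sub>n) P\<close>, up to complex conjugation of its coordinates and the
  weights of the basis, where \<open>P\<close> is a rank one projection with diagonal entries \<open>m\<^sub>n\<close> and
  \<open>1 - m\<^sub>n\<close>. Its eigenvalues are \<open>1\<close> and \<open>-(1 - i c\<^sub>n) / (1 + i c\<^sub>n)\<close>. Since \<open>|c\<^sub>n| \<ge> c\<close> and the sign of
  \<open>c\<^sub>n\<close> alternates, the blocks of one factor have their eigenvalues on the arc from angle \<open>0\<close> to \<open>\<theta>\<^sub>c\<close>
  and those of the other on the arc from \<open>-\<theta>\<^sub>c\<close> to \<open>0\<close>. Hence, after \<open>g\<close> is turned by half of \<open>\<theta>\<^sub>c\<close>, it
  makes an angle of at most \<open>\<theta>\<^sub>c / 2\<close> with \<open>f\<close> and with \<open>z f\<close> (\<open>conj_gram_form_bound\<close>,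
  \<open>shift_gram_form_bound\<close>), and the triangle inequality for angles bounds the angle between \<open>f\<close>
  and \<open>z f\<close> by \<open>\<theta>\<^sub>c\<close> (\<open>angle_triangle_bound\<close>).

  The numerical range bound, applied to \<open>f = z\<^sup>-\<^sup>N (1 - z)\<^sup>2\<^sup>N\<close>, says that the integral of
  \<open>(Re z - x) (2 - 2 Re z)\<^sup>2\<^sup>N\<close> is nonnegative. If \<open>y < x\<close>, the weight \<open>(2 - 2 Re z)\<^sup>2\<^sup>N\<close> is, for
  large \<open>N\<close>, exponentially larger on \<open>Re z < y\<close>, where the integrand is negative, than on \<open>Re z \<ge> x\<close>.
  So \<open>\<mu>\<close> has no mass on \<open>Re z < y\<close>
  (\<open>support_Re_ge\<close>).
\<close>

section \<open>Monic polynomials of the Szego recurrence\<close>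

text \<open>
  The reversed polynomial is \<open>z\<^sup>n\<close> times the conjugate of \<open>szego a n\<close> on the circle
  (\<open>szego_rev_on_circle\<close>); the joint recursion produces it directly as a polynomial.
\<close>

fun szego and szego_rev :: "(nat \<Rightarrow> complex) \<Rightarrow> nat \<Rightarrow> complex poly" where
  "szego a 0 = 1"
| "szego a (Suc n) = pCons 0 (szego a n) - smult (cnj (a n)) (szego_rev a n)"
| "szego_rev a 0 = 1"
| "szego_rev a (Suc n) = szego_rev a n - smult (a n) (pCons 0 (szego a n))"

lemma szego_degree_bounds:
  "degree (szego a n) \<le> n \<and> degree (szego_rev a n) \<le> n"
proof (induction n)
  case (Suc n)
  have 1: "degree (pCons 0 (szego a n)) \<le> Suc n"
    using Suc degree_pCons_le[of 0 "szego a n"] by linarith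
  have 2: "degree (smult s (szego_rev a n)) \<le> Suc n" for s
    using Suc degree_smult_le[of s "szego_rev a n"] by linarith
  have 3: "degree (smult s (pCons 0 (szego a n))) \<le> Suc n" for s
    using 1 degree_smult_le[of s "pCons 0 (szego a n)"] by linarith
  show ?case
    using 1 2 3 Suc by (auto intro!: degree_diff_le)
qed auto

lemma szego_coeff_top: "coeff (szego a n) n = 1"
  by (induction n) (use szego_degree_bounds in \<open>auto simp: coeff_eq_0 le_imp_less_Suc\<close>)

lemma szego_rev_coeff_0: "coeff (szego_rev a n) 0 = 1"
  by (induction n) auto

lemma unit_circle_cnj:
  fixes z :: complex
  assumes "z \<in> sphere 0 1"
  shows "z \<noteq> 0" "z * cnj z = 1" "cnj z * z = 1" "cnj z = inverse z"
proof -
  have n: "norm z = 1" using assms by simp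
  then show "z \<noteq> 0" by auto
  show 1: "z * cnj z = 1" using n by (simp add: complex_norm_square[symmetric])
  then show "cnj z * z = 1" by (simp add: mult.commute)
  then show "cnj z = inverse z" by (metis inverse_unique mult.commute)
qed

lemma szego_rev_on_circle:
  assumes "z \<in> sphere 0 1"
  shows "poly (szego_rev a n) z = z ^ n * cnj (poly (szego a n) z)"
proof (induction n)
  case (Suc n)
  have zn: "z ^ n * cnj z ^ n = 1"
    using unit_circle_cnj(2)[OF assms] by (simp flip: power_mult_distrib)
  have "z ^ Suc n * cnj (poly (szego a (Suc n)) z) =
    (z * cnj z) * (z ^ n * cnj (poly (szego a n) z)) -
      a n * z * (z ^ n * cnj z ^ n) * poly (szego a n) z"
    by (simp add: Suc algebra_simps)
  then show ?case
    using Suc by (simp add: zn unit_circle_cnj(2)[OF assms])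
qed auto

section \<open>The inner product of a measure on the circle\<close>

locale nontrivial_circle_measure =
  fixes M :: "complex measure"
  assumes nontrivial: "nontrivial_circle_prob_measure M"
begin

sublocale prob_space M
  using nontrivial by (simp add: nontrivial_circle_prob_measure_def)

lemma sets_M: "sets M = sets (restrict_space borel (sphere 0 1))"
  using nontrivial by (simp add: nontrivial_circle_prob_measure_def)

lemma space_M: "space M = sphere 0 1"
  using sets_eq_imp_space_eq[OF sets_M] by (simp add: space_restrict_space)

lemma continuous_integrable:
  fixes f :: "complex \<Rightarrow> 'b :: euclidean_space"
  assumes "continuous_on (sphere 0 1) f"
  shows "integrable M f"
proof -
  have "compact (f ` sphere 0 1)"
    using assms by (intro compact_continuous_image) auto
  then obtain B where B: "\<And>z. z \<in> sphere 0 1 \<Longrightarrow> norm (f z) \<le> B"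
    using compact_imp_bounded bounded_iff by (metis imageI)
  have "f \<in> borel_measurable (restrict_space borel (sphere 0 1))"
    using assms by (rule borel_measurable_continuous_on_restrict)
  then have "f \<in> borel_measurable M"
    using measurable_cong_sets[OF sets_M refl] by blast
  then show ?thesis
    using B space_M by (intro integrable_const_bound[of _ B]) auto
qed

definition ip :: "(complex \<Rightarrow> complex) \<Rightarrow> (complex \<Rightarrow> complex) \<Rightarrow> complex" where
  "ip f g = (\<integral>z. f z * cnj (g z) \<partial>M)"

abbreviation cont :: "(complex \<Rightarrow> complex) \<Rightarrow> bool" where
  "cont f \<equiv> continuous_on (sphere 0 1) f"

lemma ip_cong:
  assumes "\<And>z. z \<in> sphere 0 1 \<Longrightarrow> f z * cnj (g z) = f' z * cnj (g' z)"
  shows "ip f g = ip f' g'"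
  unfolding ip_def using assms space_M by (intro Bochner_Integration.integral_cong) auto

lemma ip_cnj: "cnj (ip f g) = ip g f"
  unfolding ip_def by (subst Bochner_Integration.integral_cnj[symmetric]) (simp add: mult.commute)

lemma integrable_ip: "cont f \<Longrightarrow> cont g \<Longrightarrow> integrable M (\<lambda>z. f z * cnj (g z))"
  by (intro continuous_integrable continuous_intros)

lemma ip_add_left:
  "cont f \<Longrightarrow> cont f' \<Longrightarrow> cont g \<Longrightarrow> ip (\<lambda>z. f z + f' z) g = ip f g + ip f' g"
  unfolding ip_def by (simp add: ring_distribs integrable_ip)

lemma ip_scale_left: "ip (\<lambda>z. s * f z) g = s * ip f g"
  unfolding ip_def by (simp add: mult.assoc)

lemma ip_diff_left:
  "cont f \<Longrightarrow> cont f' \<Longrightarrow> cont g \<Longrightarrow> ip (\<lambda>z. f z - f' z) g = ip f g - ip f' g"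
  unfolding ip_def by (simp add: ring_distribs integrable_ip)

lemma ip_scale_right: "ip f (\<lambda>z. s * g z) = cnj s * ip f g"
  by (metis ip_cnj ip_scale_left complex_cnj_mult)

lemma ip_add_right:
  "cont f \<Longrightarrow> cont g \<Longrightarrow> cont g' \<Longrightarrow> ip f (\<lambda>z. g z + g' z) = ip f g + ip f g'"
  using arg_cong[OF ip_add_left[of g g' f], where f = cnj] by (simp add: ip_cnj)

lemma ip_sum_left:
  assumes "\<And>k. k \<in> K \<Longrightarrow> cont (f k)" "cont g"
  shows "ip (\<lambda>z. \<Sum>k\<in>K. s k * f k z) g = (\<Sum>k\<in>K. s k * ip (f k) g)"
proof -
  have "ip (\<lambda>z. \<Sum>k\<in>K. s k * f k z) g = (\<integral>z. (\<Sum>k\<in>K. s k * (f k z * cnj (g z))) \<partial>M)"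
    unfolding ip_def by (simp add: sum_distrib_right mult.assoc)
  also have "\<dots> = (\<Sum>k\<in>K. s k * ip (f k) g)"
    using assms unfolding ip_def by (subst Bochner_Integration.integral_sum) (auto intro!: integrable_ip)
  finally show ?thesis .
qed

lemma ip_sum_right:
  assumes "\<And>k. k \<in> K \<Longrightarrow> cont (g k)" "cont f"
  shows "ip f (\<lambda>z. \<Sum>k\<in>K. s k * g k z) = (\<Sum>k\<in>K. cnj (s k) * ip f (g k))"
  using arg_cong[OF ip_sum_left[where s = s, OF assms], where f = cnj]
  by (simp add: ip_cnj)

lemma ip_self: "cont f \<Longrightarrow> ip f f = of_real (\<integral>z. (norm (f z))\<^sup>2 \<partial>M)"
  unfolding ip_def by (simp add: complex_norm_square[symmetric] del: of_real_power)

lemma Re_ip_self_nonneg: "cont f \<Longrightarrow> 0 \<le> Re (ip f f)"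
  by (simp add: ip_self)

lemma ip_self_real: "cont f \<Longrightarrow> ip f f = of_real (Re (ip f f))"
  by (simp add: ip_self)

lemma poly_cont: "cont (poly p)"
  by (intro continuous_intros)

lemmas cont_rules = continuous_on_const continuous_on_id continuous_on_add continuous_on_diff
  continuous_on_minus continuous_on_mult continuous_on_power continuous_on_cnj continuous_on_sum
  poly_cont

text \<open>
  A polynomial of norm zero vanishes almost everywhere, so the open set where it is nonzero misses the
  support. The support would then consist of finitely many roots.
\<close>

lemma poly_ip_self_pos:
  assumes "p \<noteq> 0"
  shows "0 < Re (ip (poly p) (poly p))"
proof (rule ccontr)
  assume "\<not> ?thesis"
  then have "(\<integral>z. (norm (poly p z))\<^sup>2 \<partial>M) = 0"
    using Re_ip_self_nonneg[OF poly_cont[of p]] by (simp add: ip_self[OF poly_cont] order.antisym)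
  then have ae: "AE z in M. (norm (poly p z))\<^sup>2 = 0"
    by (subst (asm) integral_nonneg_eq_0_iff_AE)
       (auto intro!: continuous_integrable continuous_intros)
  have "measure_support M \<subseteq> {z. poly p z = 0}"
  proof (rule subsetI, rule ccontr)
    fix z assume z: "z \<in> measure_support M" "z \<notin> {z. poly p z = 0}"
    let ?U = "{z. poly p z \<noteq> 0}"
    have op: "open ?U"
      by (intro open_Collect_neq continuous_intros)
    then have pos: "emeasure M (?U \<inter> space M) > 0"
      using z by (auto simp: measure_support_def)
    have "AE z in M. z \<notin> ?U" using ae by eventually_elim auto
    moreover have "?U \<inter> space M \<in> sets M"
      using op unfolding sets_M space_M by (auto simp: sets_restrict_space)
    ultimately have "emeasure M (?U \<inter> space M) = 0"
      by (subst (asm) AE_iff_measurable[OF _ refl]) (auto simp: Int_def conj_commute)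
    with pos show False by simp
  qed
  then show False
    using nontrivial poly_roots_finite[OF assms] finite_subset
    unfolding nontrivial_circle_prob_measure_def by blast
qed

section \<open>Orthogonal polynomials and their Gram data\<close>

lemma orthogonal_poly_lower_degree:
  assumes "\<And>k. k < n \<Longrightarrow> ip f (\<lambda>z. z ^ k) = 0" "cont f" "degree q < n"
  shows "ip f (poly q) = 0"
proof -
  have "poly q = (\<lambda>z. \<Sum>k\<le>degree q. coeff q k * z ^ k)"
    by (auto simp: poly_altdef)
  then show ?thesis
    using assms by (simp add: ip_sum_right cont_rules)
qed

definition monic_orthogonal :: "nat \<Rightarrow> complex poly \<Rightarrow> bool" where
  "monic_orthogonal n p \<longleftrightarrow> degree p = n \<and> lead_coeff p = 1 \<and>
     (\<forall>k<n. ip (poly p) (\<lambda>z. z ^ k) = 0)"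

lemma poly_pointwise:
  fixes p q :: "complex poly"
  shows "poly (p - q) = (\<lambda>z. poly p z - poly q z)"
    "poly (smult s p) = (\<lambda>z. s * poly p z)"
    "poly (pCons s p) = (\<lambda>z. s + z * poly p z)"
  by auto

lemma monic_orthogonal_unique:
  assumes "monic_orthogonal n p" "monic_orthogonal n q"
  shows "p = q"
proof (rule ccontr)
  assume "p \<noteq> q"
  have deg: "degree (p - q) < n"
  proof (cases n)
    case 0
    then have "p = q" using assms by (auto simp: monic_orthogonal_def elim!: degree_eq_zeroE)
    with \<open>p \<noteq> q\<close> show ?thesis by simp
  next
    case (Suc m)
    have "degree (p - q) \<le> n" "coeff (p - q) n = 0"
      using assms by (auto simp: monic_orthogonal_def intro: degree_diff_le)
    then show ?thesis
      using \<open>p \<noteq> q\<close> by (metis eq_iff_diff_eq_0 le_neq_implies_less leading_coeff_0_iff)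
  qed
  have diff: "ip (poly (p - q)) g = ip (poly p) g - ip (poly q) g" if "cont g" for g
    using that by (simp add: poly_pointwise ip_diff_left poly_cont)
  have "ip (poly (p - q)) (poly (p - q)) = 0"
    by (rule orthogonal_poly_lower_degree[OF _ poly_cont deg])
       (use assms in \<open>auto simp: diff monic_orthogonal_def cont_rules\<close>)
  then show False
    using poly_ip_self_pos[of "p - q"] \<open>p \<noteq> q\<close> by simp
qed

lemma monic_orthogonal_poly_eqI:
  "monic_orthogonal n p \<Longrightarrow> monic_orthogonal_poly M n = p"
  unfolding monic_orthogonal_poly_def
  using monic_orthogonal_unique
  by (intro the_equality) (auto simp: monic_orthogonal_def ip_def)

abbreviation "\<alpha> \<equiv> verblunsky M"
abbreviation "\<Phi> \<equiv> szego \<alpha>"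
abbreviation "\<Phi>r \<equiv> szego_rev \<alpha>"

definition \<kappa> :: "nat \<Rightarrow> real" where
  "\<kappa> n = Re (ip (poly (\<Phi> n)) (poly (\<Phi> n)))"

lemma \<kappa>_pos: "\<kappa> n > 0"
  unfolding \<kappa>_def using szego_coeff_top[of \<alpha> n] by (intro poly_ip_self_pos) auto

lemma ip_\<Phi>_self: "ip (poly (\<Phi> n)) (poly (\<Phi> n)) = of_real (\<kappa> n)"
  unfolding \<kappa>_def by (rule ip_self_real[OF poly_cont])

lemma ip_\<Phi>r: "k \<le> n \<Longrightarrow> ip (poly (\<Phi>r n)) (\<lambda>z. z ^ k) = cnj (ip (poly (\<Phi> n)) (\<lambda>z. z ^ (n - k)))"
  unfolding ip_cnj
proof (rule ip_cong)
  fix z :: complex assume k: "k \<le> n" and z: "z \<in> sphere 0 1"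
  have "z ^ n * cnj z ^ k = z ^ (n - k) * (z * cnj z) ^ k"
    using k by (simp add: power_mult_distrib flip: power_add mult.assoc)
  then show "poly (\<Phi>r n) z * cnj (z ^ k) = z ^ (n - k) * cnj (poly (\<Phi> n) z)"
    using unit_circle_cnj[OF z] szego_rev_on_circle[OF z] by (simp add: mult_ac)
qed

text \<open>
  A monic orthogonal polynomial pairs with \<open>z\<^sup>n\<close> as it does with itself, since the two differ by terms of
  lower degree.
\<close>

lemma ip_top_power:
  assumes "monic_orthogonal n p"
  shows "ip (poly p) (\<lambda>z. z ^ n) = ip (poly p) (poly p)"
proof -
  have "degree p = n" "coeff p n = 1" "\<And>k. k < n \<Longrightarrow> ip (poly p) (\<lambda>z. z ^ k) = 0"
    using assms by (auto simp: monic_orthogonal_def)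
  moreover have "poly p = (\<lambda>z. \<Sum>k\<le>degree p. coeff p k * z ^ k)"
    by (auto simp: poly_altdef)
  ultimately have "ip (poly p) (poly p) = (\<Sum>k\<le>n. cnj (coeff p k) * ip (poly p) (\<lambda>z. z ^ k))"
    using ip_sum_right[of "{..n}" "\<lambda>k z. z ^ k" "poly p" "coeff p"]
    by (simp add: cont_rules)
  also have "\<dots> = (\<Sum>k\<in>{n}. cnj (coeff p k) * ip (poly p) (\<lambda>z. z ^ k))"
    using \<open>\<And>k. k < n \<Longrightarrow> _ k\<close> by (intro sum.mono_neutral_right) auto
  finally show ?thesis using \<open>coeff p n = 1\<close> by simp
qed

text \<open>
  This is the Szego recurrence. The polynomial \<open>z \<Phi>\<^sub>n\<close> is orthogonal to \<open>z, \<dots>, z\<^sup>n\<close>, and so is the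
  reversed polynomial, whose pairing with \<open>1\<close> is \<open>\<kappa>\<^sub>n > 0\<close>. A multiple of the latter therefore
  repairs the orthogonality to \<open>1\<close>. By uniqueness the result is the next orthogonal polynomial, and
  its value at \<open>0\<close> identifies the multiplier as the Verblunsky coefficient.
\<close>

lemma \<Phi>_monic_orthogonal: "monic_orthogonal n (\<Phi> n)"
proof (induction n)
  case 0
  then show ?case by (simp add: monic_orthogonal_def)
next
  case (Suc n)
  \<comment> \<open>the multiplier that makes \<open>z \<Phi>\<^sub>n - cnj a \<Phi>r\<^sub>n\<close> orthogonal to \<open>1\<close>\<close>
  define a where "a = cnj (ip (\<lambda>z. z * poly (\<Phi> n) z) (\<lambda>z. 1) / of_real (\<kappa> n))"
  define P where "P = pCons 0 (\<Phi> n) - smult (cnj a) (\<Phi>r n)"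
  have top: "ip (poly (\<Phi>r n)) (\<lambda>z. 1) = of_real (\<kappa> n)"
    using ip_\<Phi>r[of 0 n] ip_top_power[OF Suc] by (simp add: ip_\<Phi>_self)
  have P: "ip (poly P) g = ip (\<lambda>z. z * poly (\<Phi> n) z) g - cnj a * ip (poly (\<Phi>r n)) g" if "cont g" for g
    using that
    by (simp add: P_def[THEN arg_cong[where f = poly]] poly_pointwise ip_diff_left ip_scale_left cont_rules)
  have "ip (poly P) (\<lambda>z. z ^ k) = 0" if "k < Suc n" for k
  proof (cases k)
    case 0
    then show ?thesis using \<kappa>_pos[of n] by (simp add: P top a_def)
  next
    case (Suc j)
    have "ip (\<lambda>z. z * poly (\<Phi> n) z) (\<lambda>z. z ^ k) = ip (poly (\<Phi> n)) (\<lambda>z. z ^ j)"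
      using unit_circle_cnj unfolding Suc by (intro ip_cong) (simp add: mult_ac)
    moreover have "ip (poly (\<Phi>r n)) (\<lambda>z. z ^ k) = 0"
      using ip_\<Phi>r[of k n] that Suc Suc.IH by (simp add: monic_orthogonal_def)
    ultimately show ?thesis
      using Suc.IH that Suc by (simp add: P cont_rules monic_orthogonal_def)
  qed
  moreover have "degree P \<le> Suc n"
    unfolding P_def using szego_degree_bounds[of \<alpha> n] degree_smult_le[of "cnj a" "\<Phi>r n"]
      degree_pCons_le[of 0 "\<Phi> n"] by (intro degree_diff_le) auto
  moreover have "coeff P (Suc n) = 1"
    using szego_degree_bounds[of \<alpha> n] by (simp add: P_def szego_coeff_top coeff_eq_0)
  ultimately have mo: "monic_orthogonal (Suc n) P"
    unfolding monic_orthogonal_def by (metis le_antisym le_degree zero_neq_one)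
  have "\<alpha> n = a"
    unfolding verblunsky_def monic_orthogonal_poly_eqI[OF mo]
    by (simp add: P_def poly_0_coeff_0 szego_rev_coeff_0)
  then show ?case using mo by (simp add: P_def)
qed

lemma ip_\<Phi>r_self: "ip (poly (\<Phi>r n)) (poly (\<Phi>r n)) = of_real (\<kappa> n)"
proof -
  have "ip (poly (\<Phi>r n)) (poly (\<Phi>r n)) = ip (poly (\<Phi> n)) (poly (\<Phi> n))"
  proof (rule ip_cong)
    fix z :: complex assume z: "z \<in> sphere 0 1"
    have "z ^ n * cnj z ^ n = 1"
      using unit_circle_cnj(2)[OF z] by (simp flip: power_mult_distrib)
    then show "poly (\<Phi>r n) z * cnj (poly (\<Phi>r n) z) = poly (\<Phi> n) z * cnj (poly (\<Phi> n) z)"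
      by (simp add: szego_rev_on_circle[OF z])
  qed
  then show ?thesis by (simp add: ip_\<Phi>_self)
qed

lemma ip_\<Phi>_Suc_\<Phi>r: "ip (poly (\<Phi> (Suc n))) (poly (\<Phi>r n)) = 0"
  using \<Phi>_monic_orthogonal[of "Suc n"] szego_degree_bounds[of \<alpha> n]
  by (intro orthogonal_poly_lower_degree[where n = "Suc n"])
     (auto simp: monic_orthogonal_def poly_cont simp del: szego.simps)

lemma ip_\<Phi>r_\<Phi>_Suc: "ip (poly (\<Phi>r n)) (poly (\<Phi> (Suc n))) = 0"
  using arg_cong[OF ip_\<Phi>_Suc_\<Phi>r, where f = cnj] by (simp add: ip_cnj del: szego.simps)

lemma z_\<Phi>: "z * poly (\<Phi> n) z = poly (\<Phi> (Suc n)) z + cnj (\<alpha> n) * poly (\<Phi>r n) z"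
  by simp

text \<open>
  In the two-dimensional space spanned by \<open>z \<Phi>\<^sub>n\<close> and the reversed \<open>\<Phi>\<^sub>n\<close> there are two orthogonal bases:
  \<open>z \<Phi>\<^sub>n\<close> with the reversed \<open>\<Phi>\<^sub>n\<^sub>+\<^sub>1\<close>, and the reversed \<open>\<Phi>\<^sub>n\<close> with \<open>\<Phi>\<^sub>n\<^sub>+\<^sub>1\<close>. The inner products between
  these bases, computed in this and the following lemmas, are the entries of the CMV blocks.
\<close>

lemma ip_z_\<Phi>_\<Phi>r: "ip (\<lambda>z. z * poly (\<Phi> n) z) (poly (\<Phi>r n)) = cnj (\<alpha> n) * of_real (\<kappa> n)"
  unfolding z_\<Phi>
  by (simp add: ip_add_left ip_scale_left ip_\<Phi>_Suc_\<Phi>r ip_\<Phi>r_self cont_rules del: szego.simps)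

lemma ip_z_\<Phi>_\<Phi>_Suc: "ip (\<lambda>z. z * poly (\<Phi> n) z) (poly (\<Phi> (Suc n))) = of_real (\<kappa> (Suc n))"
  unfolding z_\<Phi>
  by (simp add: ip_add_left ip_scale_left ip_\<Phi>r_\<Phi>_Suc ip_\<Phi>_self cont_rules del: szego.simps)

lemma ip_\<Phi>r_Suc_\<Phi>r: "ip (poly (\<Phi>r (Suc n))) (poly (\<Phi>r n)) = of_real (\<kappa> (Suc n))"
proof -
  have "ip (poly (\<Phi>r (Suc n))) (poly (\<Phi>r n)) = ip (\<lambda>z. z * poly (\<Phi> n) z) (poly (\<Phi> (Suc n)))"
  proof (rule ip_cong)
    fix z :: complex assume z: "z \<in> sphere 0 1"
    have "z ^ n * cnj z ^ n = 1"
      using unit_circle_cnj(2)[OF z] by (simp flip: power_mult_distrib)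
    moreover have "poly (\<Phi>r (Suc n)) z * cnj (poly (\<Phi>r n) z)
      = (z ^ n * cnj z ^ n) * (z * poly (\<Phi> n) z * cnj (poly (\<Phi> (Suc n)) z))"
      by (simp add: szego_rev_on_circle[OF z] mult_ac del: szego.simps szego_rev.simps)
    ultimately show "poly (\<Phi>r (Suc n)) z * cnj (poly (\<Phi>r n) z)
      = z * poly (\<Phi> n) z * cnj (poly (\<Phi> (Suc n)) z)"
      by (simp only: mult_1)
  qed
  then show ?thesis by (simp add: ip_z_\<Phi>_\<Phi>_Suc del: szego.simps szego_rev.simps)
qed

lemma ip_\<Phi>r_Suc_\<Phi>_Suc:
  "ip (poly (\<Phi>r (Suc n))) (poly (\<Phi> (Suc n))) = - \<alpha> n * of_real (\<kappa> (Suc n))"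
proof -
  have "poly (\<Phi>r (Suc n)) = (\<lambda>z. poly (\<Phi>r n) z - \<alpha> n * (z * poly (\<Phi> n) z))"
    by auto
  then show ?thesis
    by (simp add: ip_diff_left ip_scale_left ip_z_\<Phi>_\<Phi>_Suc ip_\<Phi>r_\<Phi>_Suc cont_rules
        del: szego.simps szego_rev.simps)
qed

lemma \<kappa>_Suc: "\<kappa> (Suc n) = (1 - (cmod (\<alpha> n))\<^sup>2) * \<kappa> n"
proof -
  have "of_real (\<kappa> n) = ip (\<lambda>z. z * poly (\<Phi> n) z) (\<lambda>z. z * poly (\<Phi> n) z)"
    unfolding ip_\<Phi>_self[symmetric]
  proof (rule ip_cong)
    fix z :: complex assume z: "z \<in> sphere 0 1"
    have "z * poly (\<Phi> n) z * cnj (z * poly (\<Phi> n) z)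
      = (z * cnj z) * (poly (\<Phi> n) z * cnj (poly (\<Phi> n) z))"
      by (simp only: complex_cnj_mult mult_ac)
    then show "poly (\<Phi> n) z * cnj (poly (\<Phi> n) z)
      = z * poly (\<Phi> n) z * cnj (z * poly (\<Phi> n) z)"
      by (simp only: unit_circle_cnj(2)[OF z] mult_1)
  qed
  also have "\<dots> = ip (\<lambda>z. z * poly (\<Phi> n) z) (\<lambda>z. poly (\<Phi> (Suc n)) z + cnj (\<alpha> n) * poly (\<Phi>r n) z)"
    by (rule ip_cong) (simp only: z_\<Phi>)
  also have "\<dots> = ip (\<lambda>z. z * poly (\<Phi> n) z) (poly (\<Phi> (Suc n)))
      + ip (\<lambda>z. z * poly (\<Phi> n) z) (\<lambda>z. cnj (\<alpha> n) * poly (\<Phi>r n) z)"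
    by (intro ip_add_right cont_rules)
  also have "\<dots> = of_real (\<kappa> (Suc n)) + \<alpha> n * (cnj (\<alpha> n) * of_real (\<kappa> n))"
    by (simp only: ip_scale_right ip_z_\<Phi>_\<Phi>r ip_z_\<Phi>_\<Phi>_Suc complex_cnj_cnj)
  also have "\<dots> = of_real (\<kappa> (Suc n) + (cmod (\<alpha> n))\<^sup>2 * \<kappa> n)"
    by (simp only: of_real_add of_real_mult complex_norm_square mult.assoc)
  finally have "\<kappa> n = \<kappa> (Suc n) + (cmod (\<alpha> n))\<^sup>2 * \<kappa> n"
    by (simp only: of_real_eq_iff)
  then show ?thesis by (simp add: algebra_simps)
qed

end

section \<open>Laurent polynomials and the CMV basis\<close>

definition laurent :: "int \<Rightarrow> int \<Rightarrow> (complex \<Rightarrow> complex) \<Rightarrow> bool" where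
  "laurent a b f \<longleftrightarrow> (\<exists>u. \<forall>z\<in>sphere 0 1. f z = (\<Sum>j\<in>{a..b}. u j * z powi j))"

lemma laurent_lincomb:
  assumes "laurent a b f" "laurent a b g"
  shows "laurent a b (\<lambda>z. f z - s * g z)"
proof -
  obtain u v where "\<And>z. z \<in> sphere 0 1 \<Longrightarrow> f z = (\<Sum>j\<in>{a..b}. u j * z powi j)"
    "\<And>z. z \<in> sphere 0 1 \<Longrightarrow> g z = (\<Sum>j\<in>{a..b}. v j * z powi j)"
    using assms by (auto simp: laurent_def)
  then show ?thesis
    unfolding laurent_def
    by (intro exI[of _ "\<lambda>j. u j - s * v j"])
       (simp add: sum_subtractf sum_distrib_left algebra_simps)
qed

lemma laurent_cong:
  assumes "laurent a b f" "\<And>z. z \<in> sphere 0 1 \<Longrightarrow> f z = g z"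
  shows "laurent a b g"
  using assms unfolding laurent_def by metis

lemma laurent_shift:
  assumes "laurent a b f" "a' = a + i" "b' = b + i"
  shows "laurent a' b' (\<lambda>z. z powi i * f z)"
proof -
  obtain u where u: "\<And>z. z \<in> sphere 0 1 \<Longrightarrow> f z = (\<Sum>j\<in>{a..b}. u j * z powi j)"
    using assms(1) by (auto simp: laurent_def)
  have "z powi i * f z = (\<Sum>j\<in>{a'..b'}. u (j - i) * z powi j)" if z: "z \<in> sphere 0 1" for z
  proof -
    have "z powi i * f z = (\<Sum>j\<in>{a..b}. u j * z powi (j + i))"
      using unit_circle_cnj(1)[OF z] by (simp add: u[OF z] sum_distrib_left power_int_add mult_ac)
    also have "\<dots> = (\<Sum>j\<in>{a'..b'}. u (j - i) * z powi j)"
      by (rule sum.reindex_bij_witness[of _ "\<lambda>j. j - i" "\<lambda>j. j + i"]) (auto simp: assms)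
    finally show ?thesis .
  qed
  then show ?thesis
    unfolding laurent_def by (intro exI[of _ "\<lambda>j. u (j - i)"]) simp
qed

lemma cnj_powi: "z \<in> sphere 0 1 \<Longrightarrow> cnj z powi j = z powi (- j)"
  by (simp add: unit_circle_cnj(4) power_int_minus power_int_inverse)

lemma laurent_cnj:
  assumes "laurent a b f"
  shows "laurent (- b) (- a) (\<lambda>z. cnj (f z))"
proof -
  obtain u where u: "\<And>z. z \<in> sphere 0 1 \<Longrightarrow> f z = (\<Sum>j\<in>{a..b}. u j * z powi j)"
    using assms(1) by (auto simp: laurent_def)
  have "cnj (f z) = (\<Sum>j\<in>{-b..-a}. cnj (u (- j)) * z powi j)" if z: "z \<in> sphere 0 1" for z
  proof -
    have "cnj (f z) = (\<Sum>j\<in>{a..b}. cnj (u j) * z powi (- j))"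
      by (simp add: u[OF z] cnj_powi[OF z])
    also have "\<dots> = (\<Sum>j\<in>{-b..-a}. cnj (u (- j)) * z powi j)"
      by (rule sum.reindex_bij_witness[of _ uminus uminus]) auto
    finally show ?thesis .
  qed
  then show ?thesis
    unfolding laurent_def by (intro exI[of _ "\<lambda>j. cnj (u (- j))"]) simp
qed

lemma laurent_poly:
  assumes "degree p \<le> n"
  shows "laurent 0 (int n) (poly p)"
proof -
  have "poly p z = (\<Sum>j\<in>{0..int n}. coeff p (nat j) * z powi j)" for z
  proof -
    have "poly p z = (\<Sum>k\<le>n. coeff p k * z ^ k)"
      unfolding poly_altdef using assms by (intro sum.mono_neutral_left) (auto simp: coeff_eq_0)
    also have "\<dots> = (\<Sum>j\<in>{0..int n}. coeff p (nat j) * z powi j)"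
      by (rule sum.reindex_bij_witness[of _ nat int]) auto
    finally show ?thesis .
  qed
  then show ?thesis
    unfolding laurent_def by (intro exI[of _ "\<lambda>j. coeff p (nat j)"]) simp
qed

text \<open>
  Removing one endpoint of the exponent window is the induction step that shows that the CMV basis spans.
\<close>

lemma laurent_peel:
  assumes "laurent a b f" "j \<in> {a..b}" "{a..b} - {j} = {a'..b'}"
  shows "\<exists>s. laurent a' b' (\<lambda>z. f z - s * z powi j)"
proof -
  obtain u where u: "\<And>z. z \<in> sphere 0 1 \<Longrightarrow> f z = (\<Sum>j\<in>{a..b}. u j * z powi j)"
    using assms(1) by (auto simp: laurent_def)
  have "f z - u j * z powi j = (\<Sum>j\<in>{a'..b'}. u j * z powi j)" if "z \<in> sphere 0 1" for z
    using assms(2,3) by (simp add: u[OF that] sum.remove[of "{a..b}" j])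
  then show ?thesis
    unfolding laurent_def by (intro exI[of _ "u j"] exI[of _ u]) simp
qed

context nontrivial_circle_measure
begin

text \<open>
  This is the unnormalised CMV basis: orthogonalisation of \<open>1, z\<^sup>-\<^sup>1, z, z\<^sup>-\<^sup>2, z\<^sup>2, \<dots>\<close> in this order.
\<close>

definition cmv :: "nat \<Rightarrow> complex \<Rightarrow> complex" where
  "cmv k z = z powi (- int ((k + 1) div 2)) * poly (if even k then \<Phi> k else \<Phi>r k) z"

lemma cmv_cont: "cont (cmv k)"
  unfolding cmv_def by (intro continuous_intros) auto

lemma cmv_laurent: "laurent (- int ((k + 1) div 2)) (int (k div 2)) (cmv k)"
proof -
  have "laurent 0 (int k) (poly (if even k then \<Phi> k else \<Phi>r k))"
    using szego_degree_bounds by (intro laurent_poly) auto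
  then have "laurent (- int ((k + 1) div 2)) (int (k div 2))
    (\<lambda>z. z powi (- int ((k + 1) div 2)) * poly (if even k then \<Phi> k else \<Phi>r k) z)"
    by (rule laurent_shift) (auto elim!: evenE oddE)
  then show ?thesis by (rule laurent_cong) (simp add: cmv_def)
qed

lemma ip_cmv_powi:
  assumes "- int (k div 2) \<le> j" "j < int ((k + 1) div 2)"
  shows "ip (cmv k) (\<lambda>z. z powi j) = 0"
proof -
  define i where "i = nat (j + int ((k + 1) div 2))"
  have i: "int i = j + int ((k + 1) div 2)"
    using assms unfolding i_def by simp
  have "ip (cmv k) (\<lambda>z. z powi j) = ip (poly (if even k then \<Phi> k else \<Phi>r k)) (\<lambda>z. z ^ i)"
  proof (rule ip_cong)
    fix z :: complex assume z: "z \<in> sphere 0 1"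
    have "z powi - int ((k + 1) div 2) * z powi (- j) = z powi (- int i)"
      using unit_circle_cnj(1)[OF z] by (simp add: i algebra_simps flip: power_int_add)
    moreover have "cnj (z ^ i) = z powi (- int i)"
      using cnj_powi[OF z, of "int i"] by simp
    ultimately show "cmv k z * cnj (z powi j) = poly (if even k then \<Phi> k else \<Phi>r k) z * cnj (z ^ i)"
      by (simp add: cmv_def cnj_powi[OF z] mult_ac)
  qed
  also have "\<dots> = 0"
  proof (cases "even k")
    case True
    then have "i < k" using i assms by (auto elim!: evenE)
    then show ?thesis using True \<Phi>_monic_orthogonal[of k] by (simp add: monic_orthogonal_def)
  next
    case False
    then have "i \<le> k" "k - i < k" using i assms by (auto elim!: oddE)
    then show ?thesis using False \<Phi>_monic_orthogonal[of k] by (simp add: monic_orthogonal_def ip_\<Phi>r)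
  qed
  finally show ?thesis .
qed

lemma cmv_orthogonal:
  assumes "laurent a b f" "- int (k div 2) \<le> a" "b < int ((k + 1) div 2)"
  shows "ip (cmv k) f = 0"
proof -
  obtain u where u: "\<And>z. z \<in> sphere 0 1 \<Longrightarrow> f z = (\<Sum>j\<in>{a..b}. u j * z powi j)"
    using assms(1) by (auto simp: laurent_def)
  have "ip (cmv k) f = ip (cmv k) (\<lambda>z. \<Sum>j\<in>{a..b}. u j * z powi j)"
    by (rule ip_cong) (simp add: u)
  also have "\<dots> = (\<Sum>j\<in>{a..b}. cnj (u j) * ip (cmv k) (\<lambda>z. z powi j))"
    by (rule ip_sum_right) (auto intro!: cmv_cont continuous_intros)
  also have "\<dots> = 0"
    using assms(2,3) by (intro sum.neutral) (simp add: ip_cmv_powi)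
  finally show ?thesis .
qed

lemma ip_cmv_self: "ip (cmv k) (cmv k) = of_real (\<kappa> k)"
proof -
  have "ip (cmv k) (cmv k) = ip (poly (if even k then \<Phi> k else \<Phi>r k)) (poly (if even k then \<Phi> k else \<Phi>r k))"
  proof (rule ip_cong)
    fix z :: complex assume z: "z \<in> sphere 0 1"
    let ?p = "poly (if even k then \<Phi> k else \<Phi>r k) z"
    let ?w = "z powi (- int ((k + 1) div 2))"
    have "?w * cnj ?w = 1"
      using z by (simp add: norm_power_int del: complex_cnj_power_int flip: complex_norm_square)
    moreover have "cmv k z * cnj (cmv k z) = (?w * cnj ?w) * (?p * cnj ?p)"
      unfolding cmv_def complex_cnj_mult by (simp only: mult_ac)
    ultimately show "cmv k z * cnj (cmv k z) = ?p * cnj ?p"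
      by (simp only: mult_1)
  qed
  then show ?thesis by (auto simp: ip_\<Phi>_self ip_\<Phi>r_self)
qed

lemma ip_cmv_cmv: "ip (cmv j) (cmv k) = (if j = k then of_real (\<kappa> k) else 0)"
proof -
  have less: "ip (cmv k) (cmv j) = 0" if "j < k" for j k
  proof -
    have "(j + 1) div 2 \<le> k div 2" "j div 2 < (k + 1) div 2"
      using that by presburger+
    then show ?thesis
      using cmv_orthogonal[OF cmv_laurent[of j], of k]
      by (simp only: neg_le_iff_le of_nat_le_iff of_nat_less_iff)
  qed
  show ?thesis
    using less[of j k] less[of k j] ip_cnj[of "cmv k" "cmv j"] ip_cmv_self[of k]
    by (cases j k rule: linorder_cases) auto
qed

text \<open>
  By induction on the exponent window: \<open>cmv (Suc n)\<close> is the new power \<open>z\<^sup>e\<close> plus terms in the previous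
  window, because the polynomial is monic (even index) or its reversed form has constant term one (odd
  index).
\<close>

lemma cmv_span:
  assumes "laurent (- int ((n + 1) div 2)) (int (n div 2)) f"
  shows "\<exists>b. \<forall>z\<in>sphere 0 1. f z = (\<Sum>k<Suc n. b k * cmv k z)"
  using assms
proof (induction n arbitrary: f)
  case 0
  then have "laurent 0 0 f" by simp
  then obtain u where u: "\<forall>z\<in>sphere 0 1. f z = (\<Sum>j\<in>{0..0::int}. u j * z powi j)"
    unfolding laurent_def by blast
  show ?case by (rule exI[of _ "\<lambda>_. u 0"]) (simp add: cmv_def u)
next
  case (Suc n)
  let ?a = "- int ((n + 1) div 2)" and ?b = "int (n div 2)"
  \<comment> \<open>the exponent by which the window of \<open>Suc n\<close> exceeds that of \<open>n\<close>\<close>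
  define e where "e = (if even n then - int (n div 2) - 1 else int (Suc n div 2))"
  have e: "e \<in> {- int ((Suc n + 1) div 2)..int (Suc n div 2)}"
    "{- int ((Suc n + 1) div 2)..int (Suc n div 2)} - {e} = {?a..?b}"
  proof -
    have *: "int (Suc n div 2) = (if even n then int (n div 2) else int (n div 2) + 1)"
      "int ((Suc n + 1) div 2) = int (n div 2) + 1"
      "int ((n + 1) div 2) = (if even n then int (n div 2) else int (n div 2) + 1)"
      by (cases "even n"; simp; presburger)+
    show "e \<in> {- int ((Suc n + 1) div 2)..int (Suc n div 2)}"
      "{- int ((Suc n + 1) div 2)..int (Suc n div 2)} - {e} = {?a..?b}"
      unfolding e_def * by auto
  qed
  obtain s where s: "laurent ?a ?b (\<lambda>z. f z - s * z powi e)"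
    using laurent_peel[OF Suc.prems e] by blast
  have top: "laurent ?a ?b (\<lambda>z. cmv (Suc n) z - z powi e)"
  proof (cases "even n")
    case True
    obtain q where q: "\<Phi>r (Suc n) = pCons 1 q"
      using szego_rev_coeff_0[of \<alpha> "Suc n"] by (metis coeff_pCons_0 pCons_cases)
    have "degree q \<le> n"
      using szego_degree_bounds[of \<alpha> "Suc n"] unfolding q by (cases "q = 0") auto
    then have "laurent ?a ?b (\<lambda>z. z powi ?a * poly q z)"
      using True by (intro laurent_shift[OF laurent_poly]) (auto elim!: evenE)
    then show ?thesis
    proof (rule laurent_cong)
      fix z :: complex assume z: "z \<in> sphere 0 1"
      have "z powi ?a = z powi e * z"
        using unit_circle_cnj(1)[OF z] True by (auto simp: e_def power_int_diff elim!: evenE)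
      moreover have "- int ((Suc n + 1) div 2) = e"
        using True by (auto simp: e_def elim!: evenE)
      ultimately show "z powi ?a * poly q z = cmv (Suc n) z - z powi e"
        using True q by (simp add: cmv_def algebra_simps del: szego_rev.simps)
    qed
  next
    case False
    define q where "q = \<Phi> (Suc n) - monom 1 (Suc n)"
    have "degree q \<le> Suc n" "coeff q (Suc n) = 0"
      unfolding q_def using szego_degree_bounds[of \<alpha> "Suc n"] szego_coeff_top[of \<alpha> "Suc n"]
      by (auto intro!: degree_diff_le simp: degree_monom_le simp del: szego.simps)
    then have "degree q \<le> n"
      by (metis degree_0 le_Suc_eq leading_coeff_0_iff zero_le)
    then have "laurent ?a ?b (\<lambda>z. z powi ?a * poly q z)"
      using False by (intro laurent_shift[OF laurent_poly]) (auto elim!: oddE)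
    then show ?thesis
    proof (rule laurent_cong)
      fix z :: complex assume z: "z \<in> sphere 0 1"
      have "int (Suc n) + ?a = e" "- int ((Suc n + 1) div 2) = ?a"
        using False by (auto simp: e_def elim!: oddE)
      then have "z powi ?a * z ^ Suc n = z powi e"
        using unit_circle_cnj(1)[OF z] by (metis add.commute power_int_add power_int_of_nat)
      then show "z powi ?a * poly q z = cmv (Suc n) z - z powi e"
        using False \<open>- int ((Suc n + 1) div 2) = ?a\<close>
        by (simp add: cmv_def q_def poly_monom algebra_simps del: szego.simps)
    qed
  qed
  have "laurent ?a ?b (\<lambda>z. f z - s * cmv (Suc n) z)"
    by (rule laurent_cong[OF laurent_lincomb[OF s top, of s]]) (simp add: algebra_simps)
  then obtain b where b: "\<forall>z\<in>sphere 0 1. f z - s * cmv (Suc n) z = (\<Sum>k<Suc n. b k * cmv k z)"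
    using Suc.IH by blast
  have "f z = (\<Sum>k<Suc (Suc n). (b(Suc n := s)) k * cmv k z)" if "z \<in> sphere 0 1" for z
    using b that by (simp add: algebra_simps)
  then show ?case by blast
qed

end

section \<open>The two bilinear Gram matrices of the CMV basis\<close>

context nontrivial_circle_measure
begin

lemma cmv_even:
  assumes "even n" "z \<in> sphere 0 1"
  shows "cmv n z = z powi (- int (n div 2)) * poly (\<Phi> n) z"
    "cmv (Suc n) z = cnj z * z powi (- int (n div 2)) * poly (\<Phi>r (Suc n)) z"
    "z powi (- int (n div 2)) * z powi (- int (n div 2)) = cnj z ^ n"
proof -
  have z: "z \<noteq> 0" "cnj z = z powi (- 1)"
    using unit_circle_cnj[OF assms(2)] by (simp_all add: power_int_minus)
  obtain m where n: "n = 2 * m" using assms(1) by (elim evenE)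
  have "cnj z * z powi (- int m) = z powi (- int (Suc m))"
    unfolding z(2) power_int_add[OF disjI1[OF z(1)], symmetric] by simp
  then show "cmv n z = z powi (- int (n div 2)) * poly (\<Phi> n) z"
    "cmv (Suc n) z = cnj z * z powi (- int (n div 2)) * poly (\<Phi>r (Suc n)) z"
    by (simp_all add: cmv_def n del: szego.simps szego_rev.simps)
  have "z powi (- int m) * z powi (- int m) = z powi (- int n)"
    unfolding power_int_add[OF disjI1[OF z(1)], symmetric] by (simp add: n)
  also have "\<dots> = cnj z ^ n"
    using cnj_powi[OF assms(2), of "int n"] by simp
  finally show "z powi (- int (n div 2)) * z powi (- int (n div 2)) = cnj z ^ n"
    by (simp add: n)
qed

lemma cmv_odd:
  assumes "odd n" "z \<in> sphere 0 1"
  shows "cmv n z = z powi (- int (Suc n div 2)) * poly (\<Phi>r n) z"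
    "cmv (Suc n) z = z powi (- int (Suc n div 2)) * poly (\<Phi> (Suc n)) z"
    "cnj (z powi (- int (Suc n div 2))) * cnj (z powi (- int (Suc n div 2))) = z ^ Suc n"
proof -
  show "cmv n z = z powi (- int (Suc n div 2)) * poly (\<Phi>r n) z"
    using assms(1) by (simp add: cmv_def)
  show "cmv (Suc n) z = z powi (- int (Suc n div 2)) * poly (\<Phi> (Suc n)) z"
    using assms(1) cmv_even(1)[of "Suc n" z] assms(2) by (simp del: szego.simps)
  show "cnj (z powi (- int (Suc n div 2))) * cnj (z powi (- int (Suc n div 2))) = z ^ Suc n"
    using assms(1) arg_cong[OF cmv_even(3)[of "Suc n" z], of cnj] assms(2) by simp
qed

text \<open>
  The Gram matrices between the CMV basis and its conjugate, without and with a factor \<open>z\<close>. Each is the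
  integral of a product of two basis functions (up to conjugation and \<open>z\<close>), hence symmetric. They
  represent the two factors of multiplication by \<open>z\<close>.
\<close>

definition conj_gram :: "nat \<Rightarrow> nat \<Rightarrow> complex" where
  "conj_gram j k = ip (\<lambda>z. cnj (cmv j z)) (cmv k)"

definition shift_gram :: "nat \<Rightarrow> nat \<Rightarrow> complex" where
  "shift_gram j k = ip (\<lambda>z. z * cmv j z) (\<lambda>z. cnj (cmv k z))"

lemma conj_gram_sym: "conj_gram j k = conj_gram k j"
  unfolding conj_gram_def by (rule ip_cong) (simp add: mult.commute)

lemma shift_gram_sym: "shift_gram j k = shift_gram k j"
  unfolding shift_gram_def by (rule ip_cong) (simp add: mult_ac)

text \<open>
  The conjugate of \<open>cmv j\<close> has the reflected exponent window. Outside the pairs \<open>(2i + 1, 2i + 2)\<close> it lies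
  in the window to which \<open>cmv k\<close> is orthogonal.
\<close>

lemma conj_gram_zero:
  assumes "j < k" "odd k \<or> Suc j < k"
  shows "conj_gram j k = 0"
proof -
  have le: "j div 2 \<le> k div 2" "(j + 1) div 2 < (k + 1) div 2"
    using assms by presburger+
  have "ip (cmv k) (\<lambda>z. cnj (cmv j z)) = 0"
    by (rule cmv_orthogonal[OF laurent_cnj[OF cmv_laurent]]) (use le in simp_all)
  then show ?thesis
    unfolding conj_gram_def using ip_cnj[of "cmv k" "\<lambda>z. cnj (cmv j z)"] by simp
qed

text \<open>
  The factor \<open>z\<close> moves the reflected window by one, which moves the exceptional pairs to \<open>(2i, 2i + 1)\<close>.
\<close>

lemma shift_gram_zero:
  assumes "j < k" "even k \<or> Suc j < k"
  shows "shift_gram j k = 0"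
proof -
  have le: "j div 2 + 1 \<le> k div 2" "(j + 1) div 2 < (k + 1) div 2 + 1"
    using assms by presburger+
  have "laurent (- int (j div 2) - 1) (int ((j + 1) div 2) - 1) (\<lambda>z. z powi (- 1) * cnj (cmv j z))"
    by (rule laurent_shift[OF laurent_cnj[OF cmv_laurent]]) simp_all
  then have "ip (cmv k) (\<lambda>z. z powi (- 1) * cnj (cmv j z)) = 0"
    by (rule cmv_orthogonal) (use le in simp_all)
  moreover have "ip (cmv k) (\<lambda>z. z powi (- 1) * cnj (cmv j z)) = shift_gram j k"
    unfolding shift_gram_def using unit_circle_cnj(4) by (intro ip_cong) (simp add: mult_ac)
  ultimately show ?thesis by simp
qed

text \<open>
  The powers of \<open>z\<close> in the product of two basis functions are those that turn one of the two polynomials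
  into the conjugate of its reversed form. What remains is an inner product between the two
  bases of a single CMV block.
\<close>

lemma shift_gram_pair:
  assumes n: "even n"
  shows "shift_gram n n = cnj (\<alpha> n) * of_real (\<kappa> n)"
    "shift_gram n (Suc n) = of_real (\<kappa> (Suc n))"
    "shift_gram (Suc n) (Suc n) = - \<alpha> n * of_real (\<kappa> (Suc n))"
proof -
  define w :: "complex \<Rightarrow> complex" where "w z = z powi (- int (n div 2))" for z
  note cmv = cmv_even[OF n, folded w_def]
  show "shift_gram n n = cnj (\<alpha> n) * of_real (\<kappa> n)"
    unfolding shift_gram_def ip_z_\<Phi>_\<Phi>r[symmetric]
  proof (rule ip_cong)
    fix z :: complex assume z: "z \<in> sphere 0 1"
    have "z * cmv n z * cnj (cnj (cmv n z)) = z * poly (\<Phi> n) z * ((w z * w z) * poly (\<Phi> n) z)"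
      by (simp only: cmv(1)[OF z] complex_cnj_cnj mult_ac)
    also have "\<dots> = z * poly (\<Phi> n) z * cnj (poly (\<Phi>r n) z)"
      by (simp add: cmv(3)[OF z] szego_rev_on_circle[OF z])
    finally show "z * cmv n z * cnj (cnj (cmv n z)) = z * poly (\<Phi> n) z * cnj (poly (\<Phi>r n) z)" .
  qed
  show "shift_gram n (Suc n) = of_real (\<kappa> (Suc n))"
    unfolding shift_gram_def ip_\<Phi>r_Suc_\<Phi>r[symmetric]
  proof (rule ip_cong)
    fix z :: complex assume z: "z \<in> sphere 0 1"
    have "z * cmv n z * cnj (cnj (cmv (Suc n) z))
      = (z * cnj z) * (poly (\<Phi>r (Suc n)) z * ((w z * w z) * poly (\<Phi> n) z))"
      by (simp only: cmv(1,2)[OF z] complex_cnj_cnj mult_ac)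
    also have "\<dots> = poly (\<Phi>r (Suc n)) z * cnj (poly (\<Phi>r n) z)"
      by (simp add: cmv(3)[OF z] szego_rev_on_circle[OF z, of _ n] unit_circle_cnj(2)[OF z]
          del: szego_rev.simps)
    finally show "z * cmv n z * cnj (cnj (cmv (Suc n) z)) = poly (\<Phi>r (Suc n)) z * cnj (poly (\<Phi>r n) z)" .
  qed
  show "shift_gram (Suc n) (Suc n) = - \<alpha> n * of_real (\<kappa> (Suc n))"
    unfolding shift_gram_def ip_\<Phi>r_Suc_\<Phi>_Suc[symmetric]
  proof (rule ip_cong)
    fix z :: complex assume z: "z \<in> sphere 0 1"
    have 1: "cnj z ^ n * z ^ n = 1"
      using unit_circle_cnj(3)[OF z] by (simp flip: power_mult_distrib)
    have "z * cmv (Suc n) z * cnj (cnj (cmv (Suc n) z))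
      = (z * cnj z) * (poly (\<Phi>r (Suc n)) z * ((w z * w z) * (cnj z * poly (\<Phi>r (Suc n)) z)))"
      by (simp only: cmv(1,2)[OF z] complex_cnj_cnj mult_ac)
    also have "\<dots> = poly (\<Phi>r (Suc n)) z * (cnj z ^ n * (cnj z * poly (\<Phi>r (Suc n)) z))"
      by (simp only: cmv(3)[OF z] unit_circle_cnj(2)[OF z] mult_1)
    also have "cnj z ^ n * (cnj z * poly (\<Phi>r (Suc n)) z)
      = (cnj z ^ n * z ^ n) * (z * cnj z) * cnj (poly (\<Phi> (Suc n)) z)"
      by (simp only: szego_rev_on_circle[OF z] power_Suc mult_ac)
    finally show "z * cmv (Suc n) z * cnj (cnj (cmv (Suc n) z))
      = poly (\<Phi>r (Suc n)) z * cnj (poly (\<Phi> (Suc n)) z)"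
      by (simp only: 1 unit_circle_cnj(2)[OF z] mult_1)
  qed
qed

text \<open>
  The same holds at an odd index. The three values have the same form for both parities, so one
  estimate serves all blocks.
\<close>

lemma conj_gram_pair:
  assumes n: "odd n"
  shows "conj_gram n n = cnj (\<alpha> n) * of_real (\<kappa> n)"
    "conj_gram n (Suc n) = of_real (\<kappa> (Suc n))"
    "conj_gram (Suc n) (Suc n) = - \<alpha> n * of_real (\<kappa> (Suc n))"
proof -
  define w :: "complex \<Rightarrow> complex" where "w z = z powi (- int (Suc n div 2))" for z
  note cmv = cmv_odd[OF n, folded w_def]
  show "conj_gram n n = cnj (\<alpha> n) * of_real (\<kappa> n)"
    unfolding conj_gram_def ip_z_\<Phi>_\<Phi>r[symmetric]
  proof (rule ip_cong)
    fix z :: complex assume z: "z \<in> sphere 0 1"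
    have 1: "z ^ n * cnj z ^ n = 1"
      using unit_circle_cnj(2)[OF z] by (simp flip: power_mult_distrib)
    have "cnj (cmv n z) * cnj (cmv n z)
      = (cnj (w z) * cnj (w z)) * cnj (poly (\<Phi>r n) z) * cnj (poly (\<Phi>r n) z)"
      by (simp only: cmv(1)[OF z] complex_cnj_mult mult_ac)
    also have "\<dots> = z ^ Suc n * cnj (poly (\<Phi>r n) z) * cnj (z ^ n * cnj (poly (\<Phi> n) z))"
      by (simp only: cmv(3)[OF z] szego_rev_on_circle[OF z])
    also have "\<dots> = (z ^ n * cnj z ^ n) * (z * poly (\<Phi> n) z * cnj (poly (\<Phi>r n) z))"
      by (simp only: power_Suc complex_cnj_mult complex_cnj_cnj complex_cnj_power mult_ac)
    finally show "cnj (cmv n z) * cnj (cmv n z) = z * poly (\<Phi> n) z * cnj (poly (\<Phi>r n) z)"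
      by (simp only: 1 mult_1)
  qed
  show "conj_gram n (Suc n) = of_real (\<kappa> (Suc n))"
    unfolding conj_gram_def ip_\<Phi>r_Suc_\<Phi>r[symmetric]
  proof (rule ip_cong)
    fix z :: complex assume z: "z \<in> sphere 0 1"
    have "cnj (cmv n z) * cnj (cmv (Suc n) z)
      = (cnj (w z) * cnj (w z)) * cnj (poly (\<Phi> (Suc n)) z) * cnj (poly (\<Phi>r n) z)"
      by (simp only: cmv(1,2)[OF z] complex_cnj_mult mult_ac)
    then show "cnj (cmv n z) * cnj (cmv (Suc n) z) = poly (\<Phi>r (Suc n)) z * cnj (poly (\<Phi>r n) z)"
      by (simp only: cmv(3)[OF z] szego_rev_on_circle[OF z, of _ "Suc n"])
  qed
  show "conj_gram (Suc n) (Suc n) = - \<alpha> n * of_real (\<kappa> (Suc n))"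
    unfolding conj_gram_def ip_\<Phi>r_Suc_\<Phi>_Suc[symmetric]
  proof (rule ip_cong)
    fix z :: complex assume z: "z \<in> sphere 0 1"
    have "cnj (cmv (Suc n) z) * cnj (cmv (Suc n) z)
      = (cnj (w z) * cnj (w z)) * cnj (poly (\<Phi> (Suc n)) z) * cnj (poly (\<Phi> (Suc n)) z)"
      by (simp only: cmv(2)[OF z] complex_cnj_mult mult_ac)
    then show "cnj (cmv (Suc n) z) * cnj (cmv (Suc n) z)
      = poly (\<Phi>r (Suc n)) z * cnj (poly (\<Phi> (Suc n)) z)"
      by (simp only: cmv(3)[OF z] szego_rev_on_circle[OF z, of _ "Suc n"])
  qed
qed

end

section \<open>Lower bounds for block-diagonal forms\<close>

text \<open>
  The relation between \<open>K\<close> and \<open>K'\<close> makes the discriminant vanish for \<open>q = w x y\<close>: then \<open>4 (1 - m)\<close>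
  times the expression is \<open>K' (w x - 2 (1 - m) y)\<^sup>2\<close>. This reflects that the block contains a projection of
  rank one.
\<close>

lemma block_defect_nonneg:
  fixes m w x y K K' q :: real
  assumes m: "0 < m" "m < 1" and K: "0 \<le> K'" "4 * m * (1 - m) * K = w\<^sup>2 * K'"
    and q: "q \<le> w * x * y"
  shows "0 \<le> m * K * x\<^sup>2 + (1 - m) * K' * y\<^sup>2 - K' * q"
proof -
  have "4 * (1 - m) * (m * K * x\<^sup>2 + (1 - m) * K' * y\<^sup>2 - K' * (w * x * y))
    = (4 * m * (1 - m) * K) * x\<^sup>2 + 4 * (1 - m)\<^sup>2 * K' * y\<^sup>2 - 4 * (1 - m) * K' * (w * x * y)"
    by (simp add: algebra_simps power2_eq_square)
  also have "\<dots> = K' * (w * x - 2 * (1 - m) * y)\<^sup>2"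
    unfolding K(2) by (simp add: algebra_simps power2_eq_square)
  finally have "0 \<le> 4 * (1 - m) * (m * K * x\<^sup>2 + (1 - m) * K' * y\<^sup>2 - K' * (w * x * y))"
    using K(1) by simp
  then have "0 \<le> m * K * x\<^sup>2 + (1 - m) * K' * y\<^sup>2 - K' * (w * x * y)"
    using m by (simp add: zero_le_mult_iff)
  moreover have "K' * q \<le> K' * (w * x * y)"
    using q K(1) by (rule mult_left_mono)
  ultimately show ?thesis by linarith
qed

text \<open>
  The form of one block is \<open>S - (2 / w) T\<close>, where \<open>S\<close> is the squared norm and \<open>T \<ge> 0\<close> is the squared
  norm of the projection. The condition on \<open>E / w\<close> says that the defect term can only increase the real
  part after multiplication by \<open>E\<close>.
\<close>

lemma block_bound:
  fixes m K K' :: real and w t t' b b' E :: complex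
  assumes m: "0 < m" "m < 1" and K: "0 \<le> K'" "4 * m * (1 - m) * K = (cmod w)\<^sup>2 * K'"
    and w: "w \<noteq> 0" and t: "cmod t = 1" "w * t' = cnj w * t"
    and E: "Re (E / w) \<le> 0"
  shows "Re E * (K * (cmod b)\<^sup>2 + K' * (cmod b')\<^sup>2) \<le>
    Re (E * ((1 - 2 * m / w) * K * (b * cnj b) + K' * (t' * b * cnj b') + K' * (cnj t * b' * cnj b)
      + (1 - 2 * (1 - m) / w) * K' * (b' * cnj b')))"
proof -
  define S where "S = K * (cmod b)\<^sup>2 + K' * (cmod b')\<^sup>2"
  \<comment> \<open>the off-diagonal terms are real multiples of \<open>(Q + cnj Q) / w\<close>\<close>
  define Q where "Q = cnj w * t * b * cnj b'"
  define T where "T = m * K * (cmod b)\<^sup>2 + (1 - m) * K' * (cmod b')\<^sup>2 - K' * Re Q"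
  have "Re Q \<le> cmod w * cmod b * cmod b'"
    using complex_Re_le_cmod[of Q] by (simp add: Q_def norm_mult t)
  then have T: "0 \<le> T"
    unfolding T_def by (intro block_defect_nonneg[OF m K])
  have wt: "t' = cnj w * t / w" using w t(2) by (simp add: field_simps)
  have cross: "K' * (t' * b * cnj b') + K' * (cnj t * b' * cnj b) = 2 / w * (K' * Re Q)"
  proof -
    have "K' * (t' * b * cnj b') + K' * (cnj t * b' * cnj b) = K' / w * (Q + cnj Q)"
      using w unfolding wt Q_def by (simp add: field_simps)
    also have "\<dots> = 2 / w * (K' * Re Q)"
      by (simp add: complex_add_cnj)
    finally show ?thesis .
  qed
  have "(1 - 2 * m / w) * K * (b * cnj b) + K' * (t' * b * cnj b') + K' * (cnj t * b' * cnj b)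
      + (1 - 2 * (1 - m) / w) * K' * (b' * cnj b') =
    (1 - 2 * m / w) * K * (b * cnj b) + 2 / w * (K' * Re Q) + (1 - 2 * (1 - m) / w) * K' * (b' * cnj b')"
    using cross by (simp add: add.assoc)
  also have "\<dots> = of_real S - 2 / w * of_real T"
    unfolding S_def T_def
    by (simp add: complex_norm_square ring_distribs of_real_mult mult.assoc diff_divide_distrib add_divide_distrib
        del: of_real_power flip: of_real_power)
  finally have eq: "(1 - 2 * m / w) * K * (b * cnj b) + K' * (t' * b * cnj b') + K' * (cnj t * b' * cnj b)
      + (1 - 2 * (1 - m) / w) * K' * (b' * cnj b') = of_real S - 2 / w * of_real T" .
  have "E * (of_real S - 2 / w * of_real T) = of_real S * E - of_real (2 * T) * (E / w)"
    by (simp add: algebra_simps)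
  then have "Re (E * (of_real S - 2 / w * of_real T)) = S * Re E - 2 * T * Re (E / w)"
    by (simp only: minus_complex.simps Re_complex_of_real Im_complex_of_real times_complex.simps)
  moreover have "T * Re (E / w) \<le> 0"
    using T E by (rule mult_nonneg_nonpos)
  ultimately show ?thesis
    unfolding eq S_def[symmetric] by (simp add: mult.commute)
qed

text \<open>
  The offset \<open>s\<close> admits a leading block that is not a pair: in \<open>conj_gram\<close> the index \<open>0\<close> stands alone,
  while in \<open>shift_gram\<close> it belongs to the pair \<open>(0, 1)\<close>.
\<close>

lemma block_diagonal_form_bound:
  fixes X :: "nat \<Rightarrow> nat \<Rightarrow> complex" and S :: "nat \<Rightarrow> real"
  assumes zero: "\<And>N j. j < s + 2 * N \<Longrightarrow>
      X j (s + 2 * N) = 0 \<and> X (s + 2 * N) j = 0 \<and>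
      X j (Suc (s + 2 * N)) = 0 \<and> X (Suc (s + 2 * N)) j = 0"
    and base: "(\<Sum>k<s. S k) \<le> Re (E * (\<Sum>j<s. \<Sum>k<s. X j k))"
    and step: "\<And>n N. n = s + 2 * N \<Longrightarrow>
      S n + S (Suc n) \<le> Re (E * (X n n + X n (Suc n) + X (Suc n) n + X (Suc n) (Suc n)))"
  shows "(\<Sum>k<s + 2 * N. S k) \<le> Re (E * (\<Sum>j<s + 2 * N. \<Sum>k<s + 2 * N. X j k))"
proof (induction N)
  case 0
  then show ?case using base by simp
next
  case (Suc N)
  define n where "n = s + 2 * N"
  have n: "s + 2 * Suc N = Suc (Suc n)" by (simp add: n_def)
  have z: "X j n = 0" "X n j = 0" "X j (Suc n) = 0" "X (Suc n) j = 0" if "j < n" for j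
    using zero[of j N] that by (auto simp: n_def)
  have "(\<Sum>j<Suc (Suc n). \<Sum>k<Suc (Suc n). X j k) =
    (\<Sum>j<n. \<Sum>k<n. X j k) + (X n n + X n (Suc n) + X (Suc n) n + X (Suc n) (Suc n))"
    by (simp add: sum.distrib z)
  then have "Re (E * (\<Sum>j<Suc (Suc n). \<Sum>k<Suc (Suc n). X j k)) = Re (E * (\<Sum>j<n. \<Sum>k<n. X j k))
      + Re (E * (X n n + X n (Suc n) + X (Suc n) n + X (Suc n) (Suc n)))"
    by (simp only: distrib_left plus_complex.simps)
  moreover have "(\<Sum>k<Suc (Suc n). S k) = (\<Sum>k<n. S k) + (S n + S (Suc n))"
    by simp
  ultimately show ?case
    using Suc step[OF n_def] unfolding n n_def[symmetric] by linarith
qed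

section \<open>The numerical range of multiplication by z\<close>

context nontrivial_circle_measure
begin

lemma Re_ip_add_self:
  assumes "cont f" "cont g"
  shows "Re (ip (\<lambda>z. f z + g z) (\<lambda>z. f z + g z)) = Re (ip f f) + 2 * Re (ip f g) + Re (ip g g)"
proof -
  have "ip (\<lambda>z. f z + g z) (\<lambda>z. f z + g z) = (ip f f + ip f g) + (ip g f + ip g g)"
    using assms by (simp add: ip_add_left ip_add_right cont_rules)
  moreover have "Re (ip g f) = Re (ip f g)"
    using arg_cong[OF ip_cnj[of f g], of Re] by simp
  ultimately show ?thesis by simp
qed

text \<open>
  With \<open>\<parallel>v\<parallel>\<^sup>2 = (c\<^sup>2 + 1) S\<close> the hypotheses say that \<open>v\<close> makes an angle with cosine at least
  \<open>c / sqrt (c\<^sup>2 + 1)\<close> with \<open>a\<close> and with \<open>f\<close>; the conclusion is that the angle between \<open>a\<close> and \<open>f\<close> is at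
  most twice as large. It follows from \<open>\<parallel>a + f - s v\<parallel>\<^sup>2 \<ge> 0\<close> with the minimising real number \<open>s\<close>.
\<close>

lemma angle_triangle_bound:
  assumes cont: "cont a" "cont f" "cont v" and c: "0 \<le> c"
    and norms: "Re (ip a a) = S" "Re (ip f f) = S" "Re (ip v v) = (c\<^sup>2 + 1) * S"
    and ips: "c * S \<le> Re (ip a v)" "c * S \<le> Re (ip f v)"
  shows "(c\<^sup>2 - 1) / (c\<^sup>2 + 1) * S \<le> Re (ip a f)"
proof -
  have pos: "0 < c\<^sup>2 + 1" by (simp add: add_nonneg_pos)
  define s where "s = 2 * c / (c\<^sup>2 + 1)"
  have s: "0 \<le> s" "s * (c\<^sup>2 + 1) = 2 * c"
    using pos c by (simp_all add: s_def)
  define g where "g = (\<lambda>z. a z + f z)"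
  define w where "w = (\<lambda>z. of_real (- s) * v z)"
  have gw: "cont g" "cont w"
    using cont unfolding g_def w_def by (intro cont_rules; simp)+
  have gg: "Re (ip g g) = 2 * S + 2 * Re (ip a f)"
    unfolding g_def by (simp only: Re_ip_add_self[OF cont(1,2)] norms)
  have gv: "Re (ip g v) = Re (ip a v) + Re (ip f v)"
    unfolding g_def by (simp add: ip_add_left cont)
  have "ip g w = of_real (- s) * ip g v" "ip w w = of_real (s * s) * ip v v"
    unfolding w_def by (simp_all only: ip_scale_left ip_scale_right) simp_all
  then have ww: "Re (ip g w) = - s * Re (ip g v)" "Re (ip w w) = s * (s * (c\<^sup>2 + 1)) * S"
    by (simp_all add: norms)
  have "2 * c * S \<le> Re (ip g v)" using ips gv by linarith
  then have gv': "s * (2 * c * S) \<le> s * Re (ip g v)" using s(1) by (rule mult_left_mono)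
  have "0 \<le> Re (ip (\<lambda>z. g z + w z) (\<lambda>z. g z + w z))"
    using gw by (intro Re_ip_self_nonneg cont_rules)
  also have "\<dots> = 2 * S + 2 * Re (ip a f) - 2 * (s * Re (ip g v)) + s * (2 * c) * S"
    unfolding Re_ip_add_self[OF gw] gg ww s(2) by simp
  also have "\<dots> \<le> 2 * S + 2 * Re (ip a f) - s * (2 * c * S)"
    using gv' by (simp add: mult_ac)
  finally have "s * c * S - S \<le> Re (ip a f)"
    by simp
  moreover have "s * c - 1 = (c\<^sup>2 - 1) / (c\<^sup>2 + 1)"
    using pos by (simp add: s_def field_simps power2_eq_square)
  then have "(c\<^sup>2 - 1) / (c\<^sup>2 + 1) * S = s * c * S - S"
    by (metis left_diff_distrib mult_1)
  ultimately show ?thesis by simp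
qed

lemma ip_combination:
  fixes n :: nat
  assumes "\<And>k. cont (u k)" "\<And>k. cont (v k)"
  shows "ip (\<lambda>z. \<Sum>j<n. s j * u j z) (\<lambda>z. \<Sum>k<n. t k * v k z)
    = (\<Sum>j<n. \<Sum>k<n. s j * cnj (t k) * ip (u j) (v k))"
proof -
  have c: "cont (\<lambda>z. \<Sum>k<n. t k * v k z)"
    using assms by (intro cont_rules)
  have "ip (\<lambda>z. \<Sum>j<n. s j * u j z) (\<lambda>z. \<Sum>k<n. t k * v k z)
    = (\<Sum>j<n. s j * ip (u j) (\<lambda>z. \<Sum>k<n. t k * v k z))"
    using assms c by (intro ip_sum_left)
  also have "\<dots> = (\<Sum>j<n. s j * (\<Sum>k<n. cnj (t k) * ip (u j) (v k)))"
    using assms by (simp add: ip_sum_right)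
  finally show ?thesis by (simp add: sum_distrib_left mult.assoc)
qed

end

lemma tau_Suc: "tau c (Suc n) = tau c n * ((1 - \<i> * c (Suc n)) / (1 + \<i> * c (Suc n)))"
  unfolding tau_def by simp

lemma cmod_tau: "cmod (tau c n) = 1"
proof (induction n)
  case 0
  show ?case by (simp add: tau_def)
next
  case (Suc n)
  have "cmod (1 - \<i> * c (Suc n)) = cmod (1 + \<i> * c (Suc n))" "1 + \<i> * c (Suc n) \<noteq> 0"
    by (simp_all add: cmod_def) (simp add: complex_eq_iff)
  then show ?case using Suc by (simp add: tau_Suc norm_mult norm_divide)
qed

locale alternating_verblunsky = nontrivial_circle_measure M for M +
  fixes c :: real and cs m :: "nat \<Rightarrow> real"
  assumes c_pos: "0 < c"
    and alternating: "\<And>n. even n \<Longrightarrow> cs (Suc n) \<le> - c" "\<And>n. odd n \<Longrightarrow> c \<le> cs (Suc n)"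
    and m: "\<And>n. 0 < m (Suc n)" "\<And>n. m (Suc n) < 1"
    and \<alpha>_eq: "\<And>n. \<alpha> n = cnj (tau cs n) * (1 - 2 * m (Suc n) - \<i> * cs (Suc n)) / (1 - \<i> * cs (Suc n))"
begin

definition den :: "nat \<Rightarrow> complex" where
  "den n = 1 + \<i> * cs (Suc n)"

lemma den_nonzero: "den n \<noteq> 0"
  unfolding den_def by (simp add: complex_eq_iff)

lemma den_tau: "den n * tau cs (Suc n) = cnj (den n) * tau cs n"
  using den_nonzero[of n] by (simp add: tau_Suc den_def)

lemma tau_cnj: "cnj (tau cs n) * tau cs n = 1"
  using cmod_tau[of cs n] by (metis complex_norm_square mult.commute of_real_1 power_one)

text \<open>
  After multiplication by the phases, the diagonal entries of the block of \<open>c\<^sub>n\<^sub>+\<^sub>1\<close> become those of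
  \<open>I - (2 / w) P\<close> with \<open>w = den n\<close>.
\<close>

lemma first_diagonal: "cnj (tau cs n) * cnj (\<alpha> n) = 1 - 2 * m (Suc n) / den n"
proof -
  have "cnj (tau cs n) * cnj (\<alpha> n) = (cnj (tau cs n) * tau cs n) * ((den n - 2 * m (Suc n)) / den n)"
    unfolding \<alpha>_eq by (simp add: den_def algebra_simps)
  then show ?thesis using den_nonzero[of n] by (simp add: tau_cnj diff_divide_distrib)
qed

lemma second_diagonal: "tau cs (Suc n) * - \<alpha> n = 1 - 2 * (1 - m (Suc n)) / den n"
proof -
  have num: "1 - 2 * m (Suc n) - \<i> * cs (Suc n) = - (den n - 2 * (1 - m (Suc n)))"
    by (simp add: den_def)
  have dn: "1 - \<i> * cs (Suc n) = cnj (den n)"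
    by (simp add: den_def)
  have "- \<alpha> n = cnj (tau cs n) * ((den n - 2 * (1 - m (Suc n))) / cnj (den n))"
    unfolding \<alpha>_eq num dn
    by (simp only: mult_minus_right minus_divide_left[symmetric] minus_minus times_divide_eq_right)
  moreover have "tau cs (Suc n) = tau cs n * (cnj (den n) / den n)"
    by (simp add: tau_Suc den_def)
  ultimately have "tau cs (Suc n) * - \<alpha> n
    = (cnj (tau cs n) * tau cs n) * (cnj (den n) / cnj (den n)) * ((den n - 2 * (1 - m (Suc n))) / den n)"
    by simp
  then show ?thesis using den_nonzero[of n] by (simp add: tau_cnj diff_divide_distrib)
qed

lemma \<kappa>_ratio: "4 * m (Suc n) * (1 - m (Suc n)) * \<kappa> n = (cmod (den n))\<^sup>2 * \<kappa> (Suc n)"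
proof -
  define x y where "x = m (Suc n)" and "y = cs (Suc n)"
  have w: "(cmod (den n))\<^sup>2 = 1 + y\<^sup>2"
    by (simp add: den_def y_def cmod_power2)
  have "cmod (\<alpha> n) = cmod (1 - 2 * x - \<i> * y) / cmod (1 - \<i> * y)"
    unfolding \<alpha>_eq by (simp add: norm_mult norm_divide cmod_tau x_def y_def)
  then have "(cmod (\<alpha> n))\<^sup>2 = ((1 - 2 * x)\<^sup>2 + y\<^sup>2) / (1 + y\<^sup>2)"
    by (simp add: power_divide cmod_power2)
  moreover have "1 + y\<^sup>2 \<noteq> 0"
    by (metis add_nonneg_eq_0_iff zero_le_one zero_le_power2 zero_neq_one)
  ultimately have "(1 + y\<^sup>2) * (1 - (cmod (\<alpha> n))\<^sup>2) = 4 * x * (1 - x)"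
    by (simp add: field_simps power2_eq_square)
  then show ?thesis
    unfolding \<kappa>_Suc w x_def[symmetric] by (simp only: mult.assoc[symmetric])
qed

text \<open>
  Multiplying by these factors replaces the Verblunsky coefficients, with their \<open>\<tau>\<close> factors, by the
  entries of \<open>I - (2 / w) P\<close>. They alternate with the parity because the two index sets of pairs interlock:
  the second index of one block is the first index of the next.
\<close>

definition phase :: "nat \<Rightarrow> complex" where
  "phase k = (if even k then tau cs k else cnj (tau cs k))"

lemma phase_unit: "phase k * cnj (phase k) = 1"
  using tau_cnj[of k] by (simp add: phase_def mult.commute)

text \<open>
  Here the blocks have \<open>c\<^sub>n \<ge> c\<close>, so \<open>(c - i) / (1 + i c\<^sub>n)\<close> has nonpositive real part.
\<close>

lemma conj_gram_form_bound:
  "(\<Sum>k<1 + 2 * N. c * (\<kappa> k * (cmod (b k))\<^sup>2)) \<le>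
    Re ((of_real c - \<i>) * (\<Sum>j<1 + 2 * N. \<Sum>k<1 + 2 * N. b j * phase j * cnj (b k) * conj_gram j k))"
proof (rule block_diagonal_form_bound)
  fix N j :: nat assume j: "j < 1 + 2 * N"
  have "conj_gram j (1 + 2 * N) = 0" "conj_gram j (Suc (1 + 2 * N)) = 0"
    using j by (auto intro: conj_gram_zero)
  then show "b j * phase j * cnj (b (1 + 2 * N)) * conj_gram j (1 + 2 * N) = 0 \<and>
       b (1 + 2 * N) * phase (1 + 2 * N) * cnj (b j) * conj_gram (1 + 2 * N) j = 0 \<and>
       b j * phase j * cnj (b (Suc (1 + 2 * N))) * conj_gram j (Suc (1 + 2 * N)) = 0 \<and>
       b (Suc (1 + 2 * N)) * phase (Suc (1 + 2 * N)) * cnj (b j) * conj_gram (Suc (1 + 2 * N)) j = 0"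
    using conj_gram_sym[of j] by simp
next
  have "conj_gram 0 0 = of_real (\<kappa> 0)"
    unfolding conj_gram_def ip_\<Phi>_self[symmetric] by (rule ip_cong) (simp add: cmv_def)
  then have "b 0 * phase 0 * cnj (b 0) * conj_gram 0 0 = of_real (\<kappa> 0 * (cmod (b 0))\<^sup>2)"
    by (simp add: phase_def tau_def complex_norm_square mult_ac del: of_real_power)
  then show "(\<Sum>k<1. c * (\<kappa> k * (cmod (b k))\<^sup>2))
    \<le> Re ((of_real c - \<i>) * (\<Sum>j<1. \<Sum>k<1. b j * phase j * cnj (b k) * conj_gram j k))"
    by simp
next
  fix n N :: nat assume "n = 1 + 2 * N"
  then have odd: "odd n" by simp
  have E: "Re ((of_real c - \<i>) / den n) \<le> 0"
    using alternating(2)[OF odd] unfolding den_def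
    by (simp add: Re_divide divide_nonpos_nonneg)
  have "Re (of_real c - \<i>) * (\<kappa> n * (cmod (cnj (b n)))\<^sup>2 + \<kappa> (Suc n) * (cmod (cnj (b (Suc n))))\<^sup>2)
    \<le> Re ((of_real c - \<i>) * ((1 - 2 * m (Suc n) / den n) * \<kappa> n * (cnj (b n) * cnj (cnj (b n)))
      + \<kappa> (Suc n) * (tau cs (Suc n) * cnj (b n) * cnj (cnj (b (Suc n))))
      + \<kappa> (Suc n) * (cnj (tau cs n) * cnj (b (Suc n)) * cnj (cnj (b n)))
      + (1 - 2 * (1 - m (Suc n)) / den n) * \<kappa> (Suc n) * (cnj (b (Suc n)) * cnj (cnj (b (Suc n))))))"
    by (rule block_bound[OF m _ \<kappa>_ratio den_nonzero cmod_tau den_tau E]) (simp add: \<kappa>_pos less_imp_le)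
  also have "(1 - 2 * m (Suc n) / den n) * \<kappa> n * (cnj (b n) * cnj (cnj (b n)))
      + \<kappa> (Suc n) * (tau cs (Suc n) * cnj (b n) * cnj (cnj (b (Suc n))))
      + \<kappa> (Suc n) * (cnj (tau cs n) * cnj (b (Suc n)) * cnj (cnj (b n)))
      + (1 - 2 * (1 - m (Suc n)) / den n) * \<kappa> (Suc n) * (cnj (b (Suc n)) * cnj (cnj (b (Suc n))))
    = b n * phase n * cnj (b n) * conj_gram n n + b n * phase n * cnj (b (Suc n)) * conj_gram n (Suc n)
      + b (Suc n) * phase (Suc n) * cnj (b n) * conj_gram (Suc n) n
      + b (Suc n) * phase (Suc n) * cnj (b (Suc n)) * conj_gram (Suc n) (Suc n)"
    unfolding first_diagonal[symmetric] second_diagonal[symmetric] using odd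
    by (simp add: conj_gram_pair[OF odd] conj_gram_sym[of "Suc n" n] phase_def mult_ac)
  finally show "c * (\<kappa> n * (cmod (b n))\<^sup>2) + c * (\<kappa> (Suc n) * (cmod (b (Suc n)))\<^sup>2) \<le>
    Re ((of_real c - \<i>) * (b n * phase n * cnj (b n) * conj_gram n n + b n * phase n * cnj (b (Suc n)) * conj_gram n (Suc n)
      + b (Suc n) * phase (Suc n) * cnj (b n) * conj_gram (Suc n) n
      + b (Suc n) * phase (Suc n) * cnj (b (Suc n)) * conj_gram (Suc n) (Suc n)))"
    by (simp add: distrib_left)
qed

text \<open>
  Here the blocks have \<open>c\<^sub>n \<le> -c\<close>, so the conjugate factor \<open>c + i\<close> is the right one.
\<close>

lemma shift_gram_form_bound:
  "(\<Sum>k<2 * N. c * (\<kappa> k * (cmod (b k))\<^sup>2)) \<le>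
    Re ((of_real c + \<i>) * (\<Sum>j<2 * N. \<Sum>k<2 * N. b j * cnj (b k * phase k) * shift_gram j k))"
proof -
  have "(\<Sum>k<0 + 2 * N. c * (\<kappa> k * (cmod (b k))\<^sup>2)) \<le>
    Re ((of_real c + \<i>) * (\<Sum>j<0 + 2 * N. \<Sum>k<0 + 2 * N. b j * cnj (b k * phase k) * shift_gram j k))"
  proof (rule block_diagonal_form_bound)
    fix N j :: nat assume j: "j < 0 + 2 * N"
    have "shift_gram j (0 + 2 * N) = 0" "shift_gram j (Suc (0 + 2 * N)) = 0"
      using j by (auto intro: shift_gram_zero)
    then show "b j * cnj (b (0 + 2 * N) * phase (0 + 2 * N)) * shift_gram j (0 + 2 * N) = 0 \<and>
       b (0 + 2 * N) * cnj (b j * phase j) * shift_gram (0 + 2 * N) j = 0 \<and>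
       b j * cnj (b (Suc (0 + 2 * N)) * phase (Suc (0 + 2 * N))) * shift_gram j (Suc (0 + 2 * N)) = 0 \<and>
       b (Suc (0 + 2 * N)) * cnj (b j * phase j) * shift_gram (Suc (0 + 2 * N)) j = 0"
      using shift_gram_sym[of j] by simp
  next
    fix n N :: nat assume "n = 0 + 2 * N"
    then have even: "even n" by simp
    have E: "Re ((of_real c + \<i>) / den n) \<le> 0"
      using alternating(1)[OF even] unfolding den_def
      by (simp add: Re_divide divide_nonpos_nonneg)
    have "Re (of_real c + \<i>) * (\<kappa> n * (cmod (b n))\<^sup>2 + \<kappa> (Suc n) * (cmod (b (Suc n)))\<^sup>2)
      \<le> Re ((of_real c + \<i>) * ((1 - 2 * m (Suc n) / den n) * \<kappa> n * (b n * cnj (b n))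
        + \<kappa> (Suc n) * (tau cs (Suc n) * b n * cnj (b (Suc n)))
        + \<kappa> (Suc n) * (cnj (tau cs n) * b (Suc n) * cnj (b n))
        + (1 - 2 * (1 - m (Suc n)) / den n) * \<kappa> (Suc n) * (b (Suc n) * cnj (b (Suc n)))))"
      by (rule block_bound[OF m _ \<kappa>_ratio den_nonzero cmod_tau den_tau E]) (simp add: \<kappa>_pos less_imp_le)
    also have "(1 - 2 * m (Suc n) / den n) * \<kappa> n * (b n * cnj (b n))
        + \<kappa> (Suc n) * (tau cs (Suc n) * b n * cnj (b (Suc n)))
        + \<kappa> (Suc n) * (cnj (tau cs n) * b (Suc n) * cnj (b n))
        + (1 - 2 * (1 - m (Suc n)) / den n) * \<kappa> (Suc n) * (b (Suc n) * cnj (b (Suc n)))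
      = b n * cnj (b n * phase n) * shift_gram n n + b n * cnj (b (Suc n) * phase (Suc n)) * shift_gram n (Suc n)
        + b (Suc n) * cnj (b n * phase n) * shift_gram (Suc n) n
        + b (Suc n) * cnj (b (Suc n) * phase (Suc n)) * shift_gram (Suc n) (Suc n)"
      unfolding first_diagonal[symmetric] second_diagonal[symmetric] using even
      by (simp add: shift_gram_pair[OF even] shift_gram_sym[of "Suc n" n] phase_def mult_ac)
    finally show "c * (\<kappa> n * (cmod (b n))\<^sup>2) + c * (\<kappa> (Suc n) * (cmod (b (Suc n)))\<^sup>2) \<le>
      Re ((of_real c + \<i>) * (b n * cnj (b n * phase n) * shift_gram n n + b n * cnj (b (Suc n) * phase (Suc n)) * shift_gram n (Suc n)
        + b (Suc n) * cnj (b n * phase n) * shift_gram (Suc n) n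
        + b (Suc n) * cnj (b (Suc n) * phase (Suc n)) * shift_gram (Suc n) (Suc n)))"
      by (simp add: distrib_left)
  qed simp
  then show ?thesis by simp
qed

text \<open>
  The comparison vector is \<open>v = (c - i) g\<close>. As \<open>v\<close> stands in the second argument of \<open>\<langle>z f, v\<rangle>\<close>, its
  factor enters there conjugated, so that both form bounds apply to the same \<open>v\<close>. The vanishing
  coefficient \<open>b (1 + 2 N)\<close> completes the last pair of the form with blocks \<open>(2i, 2i + 1)\<close>.
\<close>

lemma numerical_range_span:
  assumes F_def: "F = (\<lambda>z. \<Sum>k<1 + 2 * N. b k * cmv k z)" and b: "b (1 + 2 * N) = 0"
  shows "(c\<^sup>2 - 1) / (c\<^sup>2 + 1) * Re (ip F F) \<le> Re (ip (\<lambda>z. z * F z) F)"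
proof -
  let ?K = "1 + 2 * N"
  define S where "S = (\<Sum>k<?K. \<kappa> k * (cmod (b k))\<^sup>2)"
  define G where "G = (\<lambda>z. \<Sum>k<?K. b k * phase k * cnj (cmv k z))"
  define v where "v = (\<lambda>z. (of_real c - \<i>) * G z)"
  have cont_cnj: "cont (\<lambda>z. cnj (cmv k z))" "cont (\<lambda>z. z * cmv k z)" for k
    using cmv_cont by (intro cont_rules; simp)+
  have contF: "cont F" and contG: "cont G"
    unfolding F_def G_def using cmv_cont cont_cnj by (intro cont_rules; simp)+
  have cont: "cont (\<lambda>z. z * F z)" "cont v"
    unfolding v_def using contF contG by (intro cont_rules; simp)+
  have zF: "(\<lambda>z. z * F z) = (\<lambda>z. \<Sum>k<?K. b k * (z * cmv k z))"
    unfolding F_def by (simp only: sum_distrib_left mult.left_commute)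
  have "ip F F = (\<Sum>j<?K. \<Sum>k<?K. if j = k then of_real (\<kappa> k) * (b k * cnj (b k)) else 0)"
    unfolding F_def ip_combination[OF cmv_cont cmv_cont]
    by (intro sum.cong refl) (simp add: ip_cmv_cmv mult_ac)
  also have "\<dots> = of_real S"
    by (simp add: S_def complex_norm_square del: of_real_power)
  finally have FF: "Re (ip F F) = S" by simp
  have "ip (\<lambda>z. cnj (cmv j z)) (\<lambda>z. cnj (cmv k z)) = ip (cmv k) (cmv j)" for j k
    by (rule ip_cong) simp
  then have "ip G G = (\<Sum>j<?K. \<Sum>k<?K. if k = j then of_real (\<kappa> k) * (b k * cnj (b k)) * (phase k * cnj (phase k)) else 0)"
    unfolding G_def ip_combination[OF cont_cnj(1) cont_cnj(1)]
    by (intro sum.cong refl) (simp add: ip_cmv_cmv mult_ac)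
  also have "\<dots> = of_real S"
    by (simp add: phase_unit S_def complex_norm_square del: of_real_power)
  finally have GG: "ip G G = of_real S" .
  have "ip v v = (of_real c - \<i>) * cnj (of_real c - \<i>) * ip G G"
    unfolding v_def ip_scale_left ip_scale_right by (simp only: mult.assoc)
  also have "(of_real c - \<i>) * cnj (of_real c - \<i>) = of_real (c\<^sup>2 + 1)"
    by (simp add: complex_eq_iff power2_eq_square)
  finally have vv: "Re (ip v v) = (c\<^sup>2 + 1) * S"
    unfolding GG by simp
  have zz: "Re (ip (\<lambda>z. z * F z) (\<lambda>z. z * F z)) = S"
    unfolding FF[symmetric]
  proof (rule arg_cong[of _ _ Re], rule ip_cong)
    fix z :: complex assume z: "z \<in> sphere 0 1"
    have "z * F z * cnj (z * F z) = (z * cnj z) * (F z * cnj (F z))"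
      by (simp only: complex_cnj_mult mult_ac)
    then show "z * F z * cnj (z * F z) = F z * cnj (F z)"
      by (simp only: unit_circle_cnj(2)[OF z] mult_1)
  qed
  have "ip v F = (of_real c - \<i>) * (\<Sum>j<?K. \<Sum>k<?K. b j * phase j * cnj (b k) * conj_gram j k)"
    unfolding v_def ip_scale_left G_def F_def conj_gram_def by (simp only: ip_combination[OF cont_cnj(1) cmv_cont])
  then have "c * S \<le> Re (ip v F)"
    using conj_gram_form_bound[where N = N and b = b] unfolding S_def by (simp only: sum_distrib_left)
  then have Fv: "c * S \<le> Re (ip F v)"
    using arg_cong[OF ip_cnj[of F v], of Re] by simp
  have "ip (\<lambda>z. z * F z) G = (\<Sum>j<?K. \<Sum>k<?K. b j * cnj (b k * phase k) * shift_gram j k)"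
    unfolding zF G_def shift_gram_def by (simp only: ip_combination[OF cont_cnj(2) cont_cnj(1)])
  also have "\<dots> = (\<Sum>j<2 * Suc N. \<Sum>k<2 * Suc N. b j * cnj (b k * phase k) * shift_gram j k)"
    using b by simp
  finally have "ip (\<lambda>z. z * F z) v =
      (of_real c + \<i>) * (\<Sum>j<2 * Suc N. \<Sum>k<2 * Suc N. b j * cnj (b k * phase k) * shift_gram j k)"
    unfolding v_def ip_scale_right by simp
  then have "(\<Sum>k<2 * Suc N. c * (\<kappa> k * (cmod (b k))\<^sup>2)) \<le> Re (ip (\<lambda>z. z * F z) v)"
    using shift_gram_form_bound[where N = "Suc N" and b = b] by (simp only:)
  moreover have "(\<Sum>k<2 * Suc N. c * (\<kappa> k * (cmod (b k))\<^sup>2)) = c * S"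
    using b by (simp add: S_def sum_distrib_left distrib_left)
  ultimately have zv: "c * S \<le> Re (ip (\<lambda>z. z * F z) v)" by simp
  show ?thesis
    unfolding FF by (rule angle_triangle_bound[OF cont(1) contF cont(2) less_imp_le[OF c_pos] zz FF vv zv Fv])
qed

lemma numerical_range_laurent:
  assumes "laurent (- int N) (int N) f"
  shows "(c\<^sup>2 - 1) / (c\<^sup>2 + 1) * Re (ip f f) \<le> Re (ip (\<lambda>z. z * f z) f)"
proof -
  obtain b where b: "\<And>z. z \<in> sphere 0 1 \<Longrightarrow> f z = (\<Sum>k<Suc (2 * N). b k * cmv k z)"
    using cmv_span[of "2 * N" f] assms by auto
  \<comment> \<open>the value at \<open>1 + 2 N\<close> does not occur in the sum and may be set to zero\<close>
  define b' where "b' = b(1 + 2 * N := 0)"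
  have b'_K: "b' (1 + 2 * N) = 0" by (simp add: b'_def)
  define F where "F = (\<lambda>z. \<Sum>k<1 + 2 * N. b' k * cmv k z)"
  have f: "f z = F z" if "z \<in> sphere 0 1" for z
    unfolding F_def b[OF that] b'_def by (intro sum.cong) auto
  have "ip f f = ip F F" "ip (\<lambda>z. z * f z) f = ip (\<lambda>z. z * F z) F"
    by (rule ip_cong; simp add: f)+
  then show ?thesis
    using numerical_range_span[OF F_def b'_K] by (simp only:)
qed

section \<open>Support of the measure\<close>

text \<open>
  The test function \<open>z\<^sup>-\<^sup>N (1 - z)\<^sup>2\<^sup>N\<close> has squared modulus \<open>(2 - 2 Re z)\<^sup>2\<^sup>N\<close> on the circle and
  concentrates at \<open>-1\<close>.
\<close>

lemma weighted_integral_nonneg: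
  "0 \<le> (\<integral>z. (Re z - (c\<^sup>2 - 1) / (c\<^sup>2 + 1)) * (2 - 2 * Re z) ^ (2 * N) \<partial>M)"
proof -
  let ?x = "(c\<^sup>2 - 1) / (c\<^sup>2 + 1)"
  define h :: "complex \<Rightarrow> real" where "h z = (2 - 2 * Re z) ^ (2 * N)" for z
  define f :: "complex \<Rightarrow> complex" where "f z = z powi (- int N) * poly ([:1, -1:] ^ (2 * N)) z" for z
  have "degree ([:1, -1:] ^ (2 * N) :: complex poly) \<le> 2 * N"
    using degree_power_le[of "[:1, -1 :: complex:]" "2 * N"] by simp
  then have f: "laurent (- int N) (int N) f"
    unfolding f_def by (intro laurent_shift[OF laurent_poly]) auto
  have ff: "f z * cnj (f z) = of_real (h z)" if z: "z \<in> sphere 0 1" for z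
  proof -
    have z1: "cmod z = 1" using z by simp
    have "(cmod (1 - z))\<^sup>2 = (1 - Re z)\<^sup>2 + (Im z)\<^sup>2"
      by (simp add: cmod_power2)
    also have "\<dots> = 1 - 2 * Re z + (cmod z)\<^sup>2"
      unfolding cmod_power2 by (simp add: power2_eq_square algebra_simps)
    finally have "(cmod (1 - z))\<^sup>2 = 2 - 2 * Re z"
      by (simp add: z1)
    moreover have "cmod (f z) = cmod (1 - z) ^ (2 * N)"
      by (simp add: f_def norm_mult norm_power_int z1 norm_power)
    moreover have "(cmod (1 - z) ^ (2 * N))\<^sup>2 = ((cmod (1 - z))\<^sup>2) ^ (2 * N)"
      by (simp only: power_mult[symmetric] mult.commute)
    ultimately have "(cmod (f z))\<^sup>2 = h z"
      by (simp only: h_def)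
    then show ?thesis by (metis complex_norm_square)
  qed
  have cont_h: "continuous_on (sphere 0 1) (\<lambda>z. Re z * h z)" "continuous_on (sphere 0 1) h"
    unfolding h_def by (intro continuous_intros)+
  have "ip f f = (\<integral>z. of_real (h z) \<partial>M)"
    unfolding ip_def using ff space_M by (intro Bochner_Integration.integral_cong) auto
  then have 1: "Re (ip f f) = (\<integral>z. h z \<partial>M)" by simp
  have "ip (\<lambda>z. z * f z) f = (\<integral>z. z * of_real (h z) \<partial>M)"
    unfolding ip_def using ff space_M by (intro Bochner_Integration.integral_cong) (auto simp: mult.assoc)
  moreover have "integrable M (\<lambda>z. z * of_real (h z))"
    using cont_h(2) by (intro continuous_integrable continuous_intros)
  ultimately have 2: "Re (ip (\<lambda>z. z * f z) f) = (\<integral>z. Re z * h z \<partial>M)"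
    by (simp flip: integral_Re)
  have "(\<integral>z. (Re z - ?x) * h z \<partial>M) = (\<integral>z. Re z * h z \<partial>M) - ?x * (\<integral>z. h z \<partial>M)"
    using cont_h by (simp add: left_diff_distrib continuous_integrable)
  then show ?thesis
    using numerical_range_laurent[OF f] unfolding 1 2 h_def by simp
qed

text \<open>
  If the half plane \<open>Re u < y\<close> with \<open>y < x\<close> had mass \<open>\<delta> > 0\<close>, the negative part of the weighted
  integral would be at least \<open>(x - y) (2 - 2 y)\<^sup>2\<^sup>N \<delta>\<close> in absolute value, while the positive part is at
  most \<open>2 (2 - 2 x)\<^sup>2\<^sup>N\<close>. The ratio of the two powers tends to zero.
\<close>

lemma support_Re_ge:
  assumes z: "z \<in> measure_support M"
  shows "(c\<^sup>2 - 1) / (c\<^sup>2 + 1) \<le> Re z"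
proof (rule ccontr)
  define x where "x = (c\<^sup>2 - 1) / (c\<^sup>2 + 1)"
  have c1: "0 < c\<^sup>2 + 1" by (simp add: add_nonneg_pos)
  have x: "-1 \<le> x" "x < 1" using c1 by (simp_all add: x_def field_simps)
  assume "\<not> ?thesis"
  then have "Re z < x" by (simp add: x_def)
  then obtain y where y: "Re z < y" "y < x" using dense by blast
  define U where "U = {u. Re u < y}"
  define \<delta> where "\<delta> = measure M (U \<inter> space M)"
  have U: "open U" unfolding U_def by (rule open_halfspace_Re_lt)
  then have "emeasure M (U \<inter> space M) > 0"
    using z y(1) by (auto simp: measure_support_def U_def)
  then have \<delta>: "\<delta> > 0"
    unfolding \<delta>_def by (simp add: emeasure_eq_measure)
  have U_sets: "U \<inter> space M \<in> sets M"
    using U unfolding sets_M space_M by (auto simp: sets_restrict_space)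
  have bound: "(x - y) * \<delta> \<le> 2 * ((1 - x) / (1 - y)) ^ (2 * N)" for N
  proof -
    let ?A = "(2 - 2 * y) ^ (2 * N)" and ?B = "(2 - 2 * x) ^ (2 * N)"
    have "0 \<le> (\<integral>u. (Re u - x) * (2 - 2 * Re u) ^ (2 * N) \<partial>M)"
      using weighted_integral_nonneg[of N] by (simp add: x_def)
    also have "\<dots> \<le> (\<integral>u. - ((x - y) * ?A) * indicator (U \<inter> space M) u + 2 * ?B \<partial>M)"
    proof (rule integral_mono)
      show "integrable M (\<lambda>u. (Re u - x) * (2 - 2 * Re u) ^ (2 * N))"
        by (intro continuous_integrable continuous_intros)
      show "integrable M (\<lambda>u. - ((x - y) * ?A) * indicator (U \<inter> space M) u + 2 * ?B)"
        using U_sets by (intro Bochner_Integration.integrable_add integrable_mult_right) (auto simp: emeasure_eq_measure)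
    next
      fix u assume u: "u \<in> space M"
      then have Re_u: "-1 \<le> Re u" "Re u \<le> 1"
        using abs_Re_le_cmod[of u] by (auto simp: space_M)
      have B: "0 \<le> ?B" by simp
      show "(Re u - x) * (2 - 2 * Re u) ^ (2 * N) \<le> - ((x - y) * ?A) * indicator (U \<inter> space M) u + 2 * ?B"
      proof (cases "u \<in> U")
        case True
        then have "Re u < y" by (simp add: U_def)
        then have "(x - y) * ?A \<le> (x - Re u) * (2 - 2 * Re u) ^ (2 * N)"
          using y x Re_u by (intro mult_mono power_mono) auto
        then show ?thesis using True u B by (simp add: algebra_simps)
      next
        case False
        show ?thesis
        proof (cases "Re u < x")
          case True
          then have "(Re u - x) * (2 - 2 * Re u) ^ (2 * N) \<le> 0"
            by (intro mult_nonpos_nonneg) auto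
          with B have "(Re u - x) * (2 - 2 * Re u) ^ (2 * N) \<le> 2 * ?B" by linarith
          then show ?thesis using False by simp
        next
          case 2: False
          have "(Re u - x) * (2 - 2 * Re u) ^ (2 * N) \<le> 2 * ?B"
            using 2 x Re_u by (intro mult_mono power_mono) auto
          then show ?thesis using False by simp
        qed
      qed
    qed
    also have "\<dots> = - ((x - y) * ?A) * \<delta> + 2 * ?B"
      using U_sets by (subst Bochner_Integration.integral_add)
        (auto simp: \<delta>_def emeasure_eq_measure prob_space Int_absorb1 sets.sets_into_space)
    finally have "(x - y) * \<delta> * ?A \<le> 2 * ?B" by (simp add: mult_ac)
    moreover have A: "?A = 2 ^ (2 * N) * (1 - y) ^ (2 * N)" "?B = 2 ^ (2 * N) * (1 - x) ^ (2 * N)"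
      by (simp_all flip: power_mult_distrib)
    moreover have "0 < (1 - y) ^ (2 * N)" using y x by simp
    ultimately show ?thesis
      by (simp add: power_divide pos_le_divide_eq mult_ac)
  qed
  define q where "q = (1 - x) / (1 - y)"
  have "0 \<le> q" "q < 1"
    unfolding q_def using x y by simp_all
  then have lim: "(\<lambda>N. 2 * (q\<^sup>2) ^ N) \<longlonglongrightarrow> 2 * 0"
    by (intro tendsto_intros LIMSEQ_power_zero) (simp add: abs_square_less_1)
  have le: "(x - y) * \<delta> \<le> 2 * (q\<^sup>2) ^ N" for N
    using bound[of N, folded q_def] by (simp only: power_mult)
  have "(x - y) * \<delta> \<le> 2 * 0"
    by (rule LIMSEQ_le_const[OF lim]) (use le in blast)
  moreover have "0 < (x - y) * \<delta>" using y \<delta> by simp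
  ultimately show False by simp
qed

end

text \<open>
  The cosine decreases on \<open>[0, \<pi>]\<close>; the lower half circle is reflected by \<open>t \<mapsto> 2 \<pi> - t\<close>.
\<close>

lemma theta_arcs:
  assumes "z \<in> sphere 0 1" "(c\<^sup>2 - 1) / (c\<^sup>2 + 1) \<le> Re z"
  shows "z \<in> circle_arc 0 (theta c) \<union> circle_arc (2 * pi - theta c) (2 * pi)"
proof -
  define x where "x = (c\<^sup>2 - 1) / (c\<^sup>2 + 1)"
  have c: "0 < c\<^sup>2 + 1" by (simp add: add_nonneg_pos)
  have x: "-1 \<le> x" "x \<le> 1"
    using c by (simp_all add: x_def field_simps)
  define t where "t = Arg2pi z"
  have t: "0 \<le> t" "t < 2 * pi" "z = cis t"
    using Arg2pi[of z] assms(1) by (auto simp: t_def cis_conv_exp is_Arg_def)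
  then have cos: "x \<le> cos t" using assms(2) by (simp add: x_def)
  show ?thesis
  proof (cases "t \<le> pi")
    case True
    have "t = arccos (cos t)" using True t by (simp add: arccos_cos)
    also have "\<dots> \<le> theta c"
      unfolding theta_def x_def[symmetric] using x cos by (intro arccos_le_arccos) auto
    finally have "z \<in> circle_arc 0 (theta c)"
      unfolding circle_arc_def using t assms(1) by auto
    then show ?thesis ..
  next
    case False
    have "2 * pi - t = arccos (cos (2 * pi - t))" using False t by (subst arccos_cos) auto
    also have "cos (2 * pi - t) = cos t" by (simp add: cos_diff)
    also have "arccos (cos t) \<le> theta c"
      unfolding theta_def x_def[symmetric] using x cos by (intro arccos_le_arccos) auto
    finally have "z \<in> circle_arc (2 * pi - theta c) (2 * pi)"
      unfolding circle_arc_def using t assms(1) by auto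
    then show ?thesis ..
  qed
qed

theorem theorem3p4:
  fixes c :: real and c_tilde cs d :: "nat \<Rightarrow> real" and \<mu> :: "complex measure"
  assumes "c > 0"
    and "\<And>n. n \<ge> 1 \<Longrightarrow> c_tilde n \<ge> c"
    and "\<And>n. n \<ge> 1 \<Longrightarrow> cs n = (-1) ^ n * c_tilde n"
    and "positive_chain_sequence d"
    and "associated_measure cs d \<mu>"
  shows "measure_support \<mu> \<subseteq>
           circle_arc 0 (theta c) \<union> circle_arc (2 * pi - theta c) (2 * pi)"
proof
  fix z assume z: "z \<in> measure_support \<mu>"
  have nt: "nontrivial_circle_prob_measure \<mu>"
    using assms(5) by (simp add: associated_measure_def)
  have m: "parameter_sequence d (minimal_parameter_sequence d)"
    unfolding minimal_parameter_sequence_def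
    using theI'[OF ex1_minimal_parameter_sequence[OF assms(4)]] by blast
  interpret alternating_verblunsky \<mu> c cs "minimal_parameter_sequence d"
  proof unfold_locales
    fix n :: nat
    show "0 < minimal_parameter_sequence d (Suc n)" "minimal_parameter_sequence d (Suc n) < 1"
      using m by (auto simp: parameter_sequence_def)
    show "even n \<Longrightarrow> cs (Suc n) \<le> - c" "odd n \<Longrightarrow> c \<le> cs (Suc n)"
      using assms(2,3)[of "Suc n"] by simp_all
    have "\<forall>n\<ge>1. verblunsky \<mu> (n - 1) = cnj (tau cs (n - 1)) *
        (1 - 2 * minimal_parameter_sequence d n - \<i> * cs n) / (1 - \<i> * cs n)"
      using assms(5) by (simp add: associated_measure_def)
    from this[rule_format, of "Suc n"]
    show "verblunsky \<mu> n = cnj (tau cs n) *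
        (1 - 2 * minimal_parameter_sequence d (Suc n) - \<i> * cs (Suc n)) / (1 - \<i> * cs (Suc n))"
      by simp
  qed (fact nt assms(1))+
  have "z \<in> sphere 0 1" using z by (simp add: measure_support_def space_M)
  then show "z \<in> circle_arc 0 (theta c) \<union> circle_arc (2 * pi - theta c) (2 * pi)"
    using support_Re_ge[OF z] by (rule theta_arcs)
qed

end
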